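(* (i) For $R=\mathbb A_{\mathbb Q}$, the bijection $\iota:\mathbb A_{\mathbb Q}^2\to\overline{P(\mathbb A_{\mathbb Q})}$, $\iota(x,y)=\begin{pmatrix} y&x\\0&1\end{pmatrix}$, is equivariant for the left actions of $P(\mathbb Q)$ and induces a bijection $$j:\mathcal C_{\mathbb Q}=P(\mathbb Q)\backslash\mathbb A_{\mathbb Q}^2\;\xrightarrow{\ \sim\ }\;P(\mathbb Q)\backslash\overline{P(\mathbb A_{\mathbb Q})}.$$ (ii) Let $K$ be the compact subgroup $\hat{\mathbb Z}^\times\subset GL_1(\mathbb A_{\mathbb Q})$. Then $j$ induces a canonical bijection $$\Gamma_{\mathbb Q}\;\xrightarrow{\ \sim\ }\;P(\mathbb Q)\backslash\overline{P(\mathbb A_{\mathbb Q})}/K.$$ (iii) The action of $P(\mathbb R)$ by right multiplication on $P(\mathbb Q)\backslash\overline{P(\mathbb A_{\mathbb Q})}$ is free on the open subset $V$ determined by the conditions $y_f\neq0$ and $y_\infty\neq0$, where $y_\infty\in\mathbb R$ (resp. $y_f\in\mathbb A_{\mathbb Q,f}$) is the archimedean (resp. non-archimedean) component of $y$ for $\begin{pmatrix} y&x\\0&1\end{pmatrix}\in\overline{P(\mathbb A_{\mathbb Q})}$.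
   Context: $\mathbb A_{\mathbb Q}=\mathbb A_{\mathbb Q,f}\times\mathbb R$ denotes the adeles of $\mathbb Q$. For a commutative ring $R$, $\overline{P(R)}=\left\{\begin{pmatrix} a&b\\0&1\end{pmatrix}: a,b\in R\right\}\subset M_2(R)$ and $P(R)$ is the group of those matrices with $a$ invertible; $GL_1(R)\subset P(R)$ via $a\mapsto\begin{pmatrix} a&0\\0&1\end{pmatrix}$. $P(\mathbb Q)$ acts on $\overline{P(\mathbb A_{\mathbb Q})}$ by left multiplication, and on $\mathbb A_{\mathbb Q}^2$ by $\begin{pmatrix} a&b\\0&1\end{pmatrix}\cdot(x,y)=(ax+b,ay)$. $\mathcal C_{\mathbb Q}:=P(\mathbb Q)\backslash\mathbb A_{\mathbb Q}^2$, and $\Gamma_{\mathbb Q}$ is the further quotient of $\mathcal C_{\mathbb Q}$ by the action of $\hat{\mathbb Z}^\times$ on $\mathbb A_{\mathbb Q}^2$ given by multiplication on the second adelic variable $y$. $K$ acts on $\overline{P(\mathbb A_{\mathbb Q})}$ by right multiplication via $GL_1(\mathbb A_{\mathbb Q})\subset P(\mathbb A_{\mathbb Q})$, and $P(\mathbb R)$ acts by right multiplication at the archimedean place, fixing the components $x_f,y_f$. *)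

theory Defs
  imports "HOL-Analysis.Analysis" "HOL-Algebra.QuotRing" "HOL-Algebra.Group_Action"
    "HOL-Computational_Algebra.Primes"
begin

section \<open>The field of p-adic numbers as the completion of the rationals\<close>

text \<open>
  The normalised absolute value: the exponent is minus the \<open>p\<close>-adic valuation of the reduced
  fraction \<open>fst (quotient_of x) / snd (quotient_of x)\<close>.
\<close>

definition padic_abs :: "nat \<Rightarrow> rat \<Rightarrow> real" where
  "padic_abs p x = (if x = 0 then 0 else
     real p powi (int (multiplicity (int p) (snd (quotient_of x)))
                - int (multiplicity (int p) (fst (quotient_of x)))))"

definition padic_Cauchy :: "nat \<Rightarrow> (nat \<Rightarrow> rat) \<Rightarrow> bool" where
  "padic_Cauchy p X \<longleftrightarrow> (\<forall>e>0. \<exists>N. \<forall>m\<ge>N. \<forall>n\<ge>N. padic_abs p (X m - X n) < e)"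

definition padic_Cauchy_ring :: "nat \<Rightarrow> (nat \<Rightarrow> rat) ring" where
  "padic_Cauchy_ring p =
     \<lparr>carrier = {X. padic_Cauchy p X}, mult = (\<lambda>X Y n. X n * Y n), one = (\<lambda>_. 1),
      zero = (\<lambda>_. 0), add = (\<lambda>X Y n. X n + Y n)\<rparr>"

definition padic_null :: "nat \<Rightarrow> (nat \<Rightarrow> rat) set" where
  "padic_null p = {X. padic_Cauchy p X \<and> (\<lambda>n. padic_abs p (X n)) \<longlonglongrightarrow> 0}"

definition Qp :: "nat \<Rightarrow> (nat \<Rightarrow> rat) set ring" where
  "Qp p = padic_Cauchy_ring p Quot padic_null p"

definition Qp_of_rat :: "nat \<Rightarrow> rat \<Rightarrow> (nat \<Rightarrow> rat) set" where
  "Qp_of_rat p q = padic_null p +>\<^bsub>padic_Cauchy_ring p\<^esub> (\<lambda>_. q)"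

definition Qp_abs :: "nat \<Rightarrow> (nat \<Rightarrow> rat) set \<Rightarrow> real" where
  "Qp_abs p a = (THE r. \<forall>X\<in>a. (\<lambda>n. padic_abs p (X n)) \<longlonglongrightarrow> r)"

definition Zp :: "nat \<Rightarrow> (nat \<Rightarrow> rat) set set" where
  "Zp p = {a \<in> carrier (Qp p). Qp_abs p a \<le> 1}"

text \<open>
  \<^locale>\<open>Metric_space\<close> requires symmetry and nonnegativity also outside the carrier, hence the
  dummy value there.
\<close>

definition Qp_dist :: "nat \<Rightarrow> (nat \<Rightarrow> rat) set \<Rightarrow> (nat \<Rightarrow> rat) set \<Rightarrow> real" where
  "Qp_dist p a b =
     (if a \<in> carrier (Qp p) \<and> b \<in> carrier (Qp p) then Qp_abs p (a \<ominus>\<^bsub>Qp p\<^esub> b) else 0)"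

definition Qp_topology :: "nat \<Rightarrow> (nat \<Rightarrow> rat) set topology" where
  "Qp_topology p = Metric_space.mtopology (carrier (Qp p)) (Qp_dist p)"

lemma padic_abs_0 [simp]: "padic_abs p 0 = 0"
  by (simp add: padic_abs_def)

lemma padic_abs_1 [simp]: "padic_abs p 1 = 1"
  by (simp add: padic_abs_def)

lemma padic_abs_nonneg [simp]: "padic_abs p x \<ge> 0"
  by (simp add: padic_abs_def)

lemma padic_abs_frac:
  assumes p: "prime p" and a: "a \<noteq> 0" and b: "b \<noteq> 0"
  shows "padic_abs p (of_int a / of_int b) =
    real p powi (int (multiplicity (int p) b) - int (multiplicity (int p) a))"
proof -
  define x :: rat where "x = of_int a / of_int b"
  obtain c d where q: "quotient_of x = (c, d)" by fastforce
  have d: "d > 0" using quotient_of_denom_pos[OF q] .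
  have x: "x = of_int c / of_int d" using quotient_of_div[OF q] .
  have x0: "x \<noteq> 0" using a b by (simp add: x_def)
  hence c: "c \<noteq> 0" using x by auto
  have "(of_int (c * b) :: rat) = of_int (a * d)"
    using x b d unfolding x_def by (simp add: field_simps)
  hence eq: "c * b = a * d" by (simp only: of_int_eq_iff)
  have pp: "prime_elem (int p)" using p by auto
  have "multiplicity (int p) c + multiplicity (int p) b = multiplicity (int p) a + multiplicity (int p) d"
    using prime_elem_multiplicity_mult_distrib[OF pp] a b c d eq
    by (metis less_irrefl)
  hence "int (multiplicity (int p) d) - int (multiplicity (int p) c)
       = int (multiplicity (int p) b) - int (multiplicity (int p) a)" by linarith
  thus ?thesis using x0 q unfolding x_def[symmetric] padic_abs_def by simp
qed

lemma rat_frac_ex: "\<exists>a b::int. b \<noteq> 0 \<and> (x::rat) = of_int a / of_int b"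
  by (metis Fract_of_int_quotient quotient_of_div quotient_of_denom_pos less_irrefl surj_pair)

lemma padic_abs_mult:
  assumes p: "prime p"
  shows "padic_abs p (x * y) = padic_abs p x * padic_abs p y"
proof (cases "x = 0 \<or> y = 0")
  case False
  obtain a b where x: "b \<noteq> 0" "x = of_int a / of_int b" using rat_frac_ex by blast
  obtain c d where y: "d \<noteq> 0" "y = of_int c / of_int d" using rat_frac_ex by blast
  have ac: "a \<noteq> 0" "c \<noteq> 0" using False x y by auto
  have xy: "x * y = of_int (a * c) / of_int (b * d)" using x y by simp
  have pp: "prime_elem (int p)" using p by auto
  have p0: "real p \<noteq> 0" using p by auto
  show ?thesis
    unfolding xy using x y ac p0
    by (simp add: padic_abs_frac[OF p] prime_elem_multiplicity_mult_distrib[OF pp]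
        power_int_add[symmetric] add_diff_eq diff_add_eq diff_diff_eq2 algebra_simps del: of_int_mult)
qed auto

lemma padic_abs_minus [simp]: "padic_abs p (- x) = padic_abs p x"
proof -
  have "multiplicity (int p) (- k) = multiplicity (int p) k" for k
    by (rule multiplicity_cong) simp
  thus ?thesis by (simp add: padic_abs_def rat_uminus_code case_prod_beta)
qed

lemma padic_abs_diff_commute: "padic_abs p (x - y) = padic_abs p (y - x)"
  by (metis minus_diff_eq padic_abs_minus)

lemma padic_abs_add:
  assumes p: "prime p"
  shows "padic_abs p (x + y) \<le> max (padic_abs p x) (padic_abs p y)"
proof (cases "x = 0 \<or> y = 0 \<or> x + y = 0")
  case False
  obtain a b where x: "b \<noteq> 0" "x = of_int a / of_int b" using rat_frac_ex by blast
  obtain c d where y: "d \<noteq> 0" "y = of_int c / of_int d" using rat_frac_ex by blast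
  let ?m = "multiplicity (int p)"
  have nz: "a \<noteq> 0" "c \<noteq> 0" using False x y by auto
  have pp: "prime_elem (int p)" using p by auto
  have p1: "real p > 1" using p prime_gt_1_nat by auto
  have x': "x = of_int (a * d) / of_int (b * d)" and y': "y = of_int (c * b) / of_int (b * d)"
    using x y by auto
  have xy: "x + y = of_int (a * d + c * b) / of_int (b * d)"
    using x y by (simp add: add_divide_distrib)
  have nz': "a * d + c * b \<noteq> 0"
    using False xy by (metis div_0 of_int_0)
  have "int p ^ min (?m (a * d)) (?m (c * b)) dvd a * d + c * b"
    by (intro dvd_add multiplicity_dvd') auto
  moreover have "\<not> is_unit (int p)" using pp prime_elem_not_unit by blast
  ultimately have "?m (a * d + c * b) \<ge> min (?m (a * d)) (?m (c * b))"
    using nz' by (intro multiplicity_geI) auto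
  hence "real p powi (int (?m (b * d)) - int (?m (a * d + c * b))) \<le>
     max (real p powi (int (?m (b * d)) - int (?m (a * d)))) (real p powi (int (?m (b * d)) - int (?m (c * b))))"
    unfolding le_max_iff_disj using p1 by (auto simp: min_def split: if_splits intro!: power_int_increasing)
  moreover have "padic_abs p (x + y) = real p powi (int (?m (b * d)) - int (?m (a * d + c * b)))"
    unfolding xy by (rule padic_abs_frac[OF p]) (use nz' x y in auto)
  moreover have "padic_abs p x = real p powi (int (?m (b * d)) - int (?m (a * d)))"
    unfolding x' by (rule padic_abs_frac[OF p]) (use nz x y in auto)
  moreover have "padic_abs p y = real p powi (int (?m (b * d)) - int (?m (c * b)))"
    unfolding y' by (rule padic_abs_frac[OF p]) (use nz x y in auto)
  ultimately show ?thesis by simp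
qed (auto simp: max_def)

lemma padic_abs_add_le:
  assumes p: "prime p"
  shows "padic_abs p (x + y) \<le> padic_abs p x + padic_abs p y"
  using padic_abs_add[OF p, of x y] padic_abs_nonneg[of p x] padic_abs_nonneg[of p y] by linarith

lemma padic_abs_diff:
  assumes p: "prime p"
  shows "\<bar>padic_abs p x - padic_abs p y\<bar> \<le> padic_abs p (x - y)"
  using padic_abs_add_le[OF p, of "x - y" y] padic_abs_add_le[OF p, of "y - x" x]
    padic_abs_diff_commute[of p x y] by simp

lemma padic_Cauchy_const: "padic_Cauchy p (\<lambda>_. q)"
  by (simp add: padic_Cauchy_def)

lemma padic_Cauchy_add:
  assumes p: "prime p" and "padic_Cauchy p X" "padic_Cauchy p Y"
  shows "padic_Cauchy p (\<lambda>n. X n + Y n)"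
  unfolding padic_Cauchy_def
proof (intro allI impI)
  fix e :: real assume e: "e > 0"
  obtain N where N: "\<And>m n. m \<ge> N \<Longrightarrow> n \<ge> N \<Longrightarrow> padic_abs p (X m - X n) < e"
    using assms(2) e unfolding padic_Cauchy_def by blast
  obtain M where M: "\<And>m n. m \<ge> M \<Longrightarrow> n \<ge> M \<Longrightarrow> padic_abs p (Y m - Y n) < e"
    using assms(3) e unfolding padic_Cauchy_def by blast
  have "padic_abs p (X m + Y m - (X n + Y n)) < e" if "m \<ge> max N M" "n \<ge> max N M" for m n
    using padic_abs_add[OF p, of "X m - X n" "Y m - Y n"] N[of m n] M[of m n] that
    by (simp add: algebra_simps)
  thus "\<exists>N. \<forall>m\<ge>N. \<forall>n\<ge>N. padic_abs p (X m + Y m - (X n + Y n)) < e" by blast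
qed

lemma padic_Cauchy_minus: "padic_Cauchy p X \<Longrightarrow> padic_Cauchy p (\<lambda>n. - X n)"
  unfolding padic_Cauchy_def by (simp add: padic_abs_diff_commute)

lemma padic_Cauchy_lim:
  assumes p: "prime p" and X: "padic_Cauchy p X"
  shows "\<exists>r. (\<lambda>n. padic_abs p (X n)) \<longlonglongrightarrow> r"
proof -
  have "Cauchy (\<lambda>n. padic_abs p (X n))"
    unfolding Cauchy_def dist_real_def
    using X padic_abs_diff[OF p] unfolding padic_Cauchy_def by (meson order_le_less_trans)
  thus ?thesis using real_Cauchy_convergent convergent_def by blast
qed

lemma padic_Cauchy_bdd:
  assumes p: "prime p" and X: "padic_Cauchy p X"
  shows "\<exists>B>0. \<forall>n. padic_abs p (X n) \<le> B"
proof -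
  have "Bseq (\<lambda>n. padic_abs p (X n))"
    using padic_Cauchy_lim[OF assms] convergent_def convergent_imp_Bseq by blast
  thus ?thesis unfolding Bseq_def by auto
qed

lemma padic_Cauchy_mult:
  assumes p: "prime p" and X: "padic_Cauchy p X" and Y: "padic_Cauchy p Y"
  shows "padic_Cauchy p (\<lambda>n. X n * Y n)"
  unfolding padic_Cauchy_def
proof (intro allI impI)
  fix e :: real assume e: "e > 0"
  obtain B where B: "B > 0" "\<And>n. padic_abs p (X n) \<le> B" using padic_Cauchy_bdd[OF p X] by blast
  obtain C where C: "C > 0" "\<And>n. padic_abs p (Y n) \<le> C" using padic_Cauchy_bdd[OF p Y] by blast
  obtain N where N: "\<And>m n. m \<ge> N \<Longrightarrow> n \<ge> N \<Longrightarrow> padic_abs p (X m - X n) < e / C"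
    using X e C(1) unfolding padic_Cauchy_def by (meson divide_pos_pos)
  obtain M where M: "\<And>m n. m \<ge> M \<Longrightarrow> n \<ge> M \<Longrightarrow> padic_abs p (Y m - Y n) < e / B"
    using Y e B(1) unfolding padic_Cauchy_def by (meson divide_pos_pos)
  have "padic_abs p (X m * Y m - X n * Y n) < e" if "m \<ge> max N M" "n \<ge> max N M" for m n
  proof -
    have eq: "X m * Y m - X n * Y n = X m * (Y m - Y n) + (X m - X n) * Y n"
      by (simp add: algebra_simps)
    have "padic_abs p (X m) * padic_abs p (Y m - Y n) \<le> B * padic_abs p (Y m - Y n)"
      by (intro mult_right_mono B) auto
    also have "\<dots> < e" using M[of m n] that B by (simp add: field_simps)
    finally have 1: "padic_abs p (X m) * padic_abs p (Y m - Y n) < e" .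
    have "padic_abs p (X m - X n) * padic_abs p (Y n) \<le> padic_abs p (X m - X n) * C"
      by (intro mult_left_mono C) auto
    also have "\<dots> < e" using N[of m n] that C by (simp add: field_simps)
    finally have 2: "padic_abs p (X m - X n) * padic_abs p (Y n) < e" .
    show ?thesis
      using padic_abs_add[OF p, of "X m * (Y m - Y n)" "(X m - X n) * Y n"] 1 2
      unfolding eq by (simp add: padic_abs_mult[OF p])
  qed
  thus "\<exists>N. \<forall>m\<ge>N. \<forall>n\<ge>N. padic_abs p (X m * Y m - X n * Y n) < e" by blast
qed

lemma padic_Cauchy_ring_cring:
  assumes p: "prime p"
  shows "cring (padic_Cauchy_ring p)"
proof (rule cringI)
  show "abelian_group (padic_Cauchy_ring p)"
  proof (rule abelian_groupI)
    fix X assume "X \<in> carrier (padic_Cauchy_ring p)"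
    thus "\<exists>Y\<in>carrier (padic_Cauchy_ring p). Y \<oplus>\<^bsub>padic_Cauchy_ring p\<^esub> X = \<zero>\<^bsub>padic_Cauchy_ring p\<^esub>"
      by (intro bexI[of _ "\<lambda>n. - X n"]) (auto simp: padic_Cauchy_ring_def padic_Cauchy_minus)
  qed (auto simp: padic_Cauchy_ring_def padic_Cauchy_add[OF p] padic_Cauchy_const algebra_simps)
  show "comm_monoid (padic_Cauchy_ring p)"
    by (rule comm_monoidI)
      (auto simp: padic_Cauchy_ring_def padic_Cauchy_mult[OF p] padic_Cauchy_const algebra_simps)
qed (auto simp: padic_Cauchy_ring_def algebra_simps)

lemma padic_null_ideal:
  assumes p: "prime p"
  shows "ideal (padic_null p) (padic_Cauchy_ring p)"
proof -
  interpret R: cring "padic_Cauchy_ring p" by (rule padic_Cauchy_ring_cring[OF p])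
  have inv: "\<ominus>\<^bsub>padic_Cauchy_ring p\<^esub> X = (\<lambda>n. - X n)" if "padic_Cauchy p X" for X
    by (rule R.minus_equality) (use that in \<open>auto simp: padic_Cauchy_ring_def padic_Cauchy_minus\<close>)
  have mult: "(\<lambda>n. X n * Y n) \<in> padic_null p" if "padic_Cauchy p X" "Y \<in> padic_null p" for X Y
  proof -
    obtain r where "(\<lambda>n. padic_abs p (X n)) \<longlonglongrightarrow> r"
      using padic_Cauchy_lim[OF p \<open>padic_Cauchy p X\<close>] by blast
    hence "(\<lambda>n. padic_abs p (X n) * padic_abs p (Y n)) \<longlonglongrightarrow> r * 0"
      using that(2) by (intro tendsto_mult) (auto simp: padic_null_def)
    thus ?thesis using that by (auto simp: padic_null_def padic_Cauchy_mult[OF p] padic_abs_mult[OF p])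
  qed
  have mult': "(\<lambda>n. Y n * X n) \<in> padic_null p" if "padic_Cauchy p X" "Y \<in> padic_null p" for X Y
    using mult[OF that] by (subst mult.commute)
  have add: "(\<lambda>n. X n + Y n) \<in> padic_null p" if "X \<in> padic_null p" "Y \<in> padic_null p" for X Y
  proof -
    have "(\<lambda>n. padic_abs p (X n) + padic_abs p (Y n)) \<longlonglongrightarrow> 0 + 0"
      using that by (intro tendsto_add) (auto simp: padic_null_def)
    hence "(\<lambda>n. padic_abs p (X n) + padic_abs p (Y n)) \<longlonglongrightarrow> 0" by simp
    hence "(\<lambda>n. padic_abs p (X n + Y n)) \<longlonglongrightarrow> 0"
      by (rule Lim_null_comparison[rotated]) (simp add: padic_abs_add_le[OF p])
    thus ?thesis using that by (auto simp: padic_null_def padic_Cauchy_add[OF p])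
  qed
  show ?thesis
  proof (rule idealI)
    show "subgroup (padic_null p) (add_monoid (padic_Cauchy_ring p))"
    proof (rule R.add.subgroupI)
      have "(\<lambda>_. 0) \<in> padic_null p"
        by (simp add: padic_null_def padic_Cauchy_const)
      thus "padic_null p \<noteq> {}" by blast
      show "\<And>a. a \<in> padic_null p \<Longrightarrow> \<ominus>\<^bsub>padic_Cauchy_ring p\<^esub> a \<in> padic_null p"
        using inv by (auto simp: padic_null_def padic_Cauchy_minus a_inv_def[symmetric])
    qed (use add in \<open>auto simp: padic_null_def padic_Cauchy_ring_def\<close>)
    show "\<And>a x. a \<in> padic_null p \<Longrightarrow> x \<in> carrier (padic_Cauchy_ring p)
       \<Longrightarrow> x \<otimes>\<^bsub>padic_Cauchy_ring p\<^esub> a \<in> padic_null p"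
      using mult by (auto simp: padic_Cauchy_ring_def)
    show "\<And>a x. a \<in> padic_null p \<Longrightarrow> x \<in> carrier (padic_Cauchy_ring p)
       \<Longrightarrow> a \<otimes>\<^bsub>padic_Cauchy_ring p\<^esub> x \<in> padic_null p"
      using mult' by (auto simp: padic_Cauchy_ring_def)
  qed (rule R.ring_axioms)
qed

lemma Qp_cring:
  assumes p: "prime p"
  shows "cring (Qp p)"
  unfolding Qp_def by (rule ideal.quotient_is_cring[OF padic_null_ideal[OF p] padic_Cauchy_ring_cring[OF p]])

lemma Qp_add_closed:
  assumes "prime p" "a \<in> carrier (Qp p)" "b \<in> carrier (Qp p)"
  shows "a \<oplus>\<^bsub>Qp p\<^esub> b \<in> carrier (Qp p)"
proof -
  interpret cring "Qp p" by (rule Qp_cring[OF assms(1)])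
  show ?thesis using assms by simp
qed

lemma Qp_mult_closed:
  assumes "prime p" "a \<in> carrier (Qp p)" "b \<in> carrier (Qp p)"
  shows "a \<otimes>\<^bsub>Qp p\<^esub> b \<in> carrier (Qp p)"
proof -
  interpret cring "Qp p" by (rule Qp_cring[OF assms(1)])
  show ?thesis using assms by simp
qed

lemma Qp_uminus_closed:
  assumes "prime p" "a \<in> carrier (Qp p)"
  shows "\<ominus>\<^bsub>Qp p\<^esub> a \<in> carrier (Qp p)"
proof -
  interpret cring "Qp p" by (rule Qp_cring[OF assms(1)])
  show ?thesis using assms by simp
qed

lemma Qp_carrier_cases:
  assumes "a \<in> carrier (Qp p)"
  obtains X where "padic_Cauchy p X" "a = padic_null p +>\<^bsub>padic_Cauchy_ring p\<^esub> X"
  using assms by (auto simp: Qp_def FactRing_def A_RCOSETS_def' padic_Cauchy_ring_def)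

lemma Qp_class_carrier:
  "padic_Cauchy p X \<Longrightarrow> padic_null p +>\<^bsub>padic_Cauchy_ring p\<^esub> X \<in> carrier (Qp p)"
  by (auto simp: Qp_def FactRing_def A_RCOSETS_def' padic_Cauchy_ring_def)

lemma Qp_class_add:
  assumes p: "prime p" and "padic_Cauchy p X" "padic_Cauchy p Y"
  shows "(padic_null p +>\<^bsub>padic_Cauchy_ring p\<^esub> X) \<oplus>\<^bsub>Qp p\<^esub> (padic_null p +>\<^bsub>padic_Cauchy_ring p\<^esub> Y)
    = padic_null p +>\<^bsub>padic_Cauchy_ring p\<^esub> (\<lambda>n. X n + Y n)"
proof -
  interpret I: ideal "padic_null p" "padic_Cauchy_ring p" by (rule padic_null_ideal[OF p])
  have "(padic_null p +>\<^bsub>padic_Cauchy_ring p\<^esub> X) <+>\<^bsub>padic_Cauchy_ring p\<^esub> (padic_null p +>\<^bsub>padic_Cauchy_ring p\<^esub> Y)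
     = padic_null p +>\<^bsub>padic_Cauchy_ring p\<^esub> (X \<oplus>\<^bsub>padic_Cauchy_ring p\<^esub> Y)"
    by (rule I.a_rcos_sum) (use assms in \<open>auto simp: padic_Cauchy_ring_def\<close>)
  thus ?thesis by (simp add: Qp_def FactRing_def) (simp add: padic_Cauchy_ring_def)
qed

lemma Qp_class_mult:
  assumes p: "prime p" and "padic_Cauchy p X" "padic_Cauchy p Y"
  shows "(padic_null p +>\<^bsub>padic_Cauchy_ring p\<^esub> X) \<otimes>\<^bsub>Qp p\<^esub> (padic_null p +>\<^bsub>padic_Cauchy_ring p\<^esub> Y)
    = padic_null p +>\<^bsub>padic_Cauchy_ring p\<^esub> (\<lambda>n. X n * Y n)"
proof -
  interpret I: ideal "padic_null p" "padic_Cauchy_ring p" by (rule padic_null_ideal[OF p])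
  have "[mod padic_null p:] (padic_null p +>\<^bsub>padic_Cauchy_ring p\<^esub> X) \<Otimes>\<^bsub>padic_Cauchy_ring p\<^esub> (padic_null p +>\<^bsub>padic_Cauchy_ring p\<^esub> Y)
     = padic_null p +>\<^bsub>padic_Cauchy_ring p\<^esub> (X \<otimes>\<^bsub>padic_Cauchy_ring p\<^esub> Y)"
    by (rule I.rcoset_mult_add) (use assms in \<open>auto simp: padic_Cauchy_ring_def\<close>)
  thus ?thesis by (simp add: Qp_def FactRing_def) (simp add: padic_Cauchy_ring_def)
qed

lemma Qp_one: "\<one>\<^bsub>Qp p\<^esub> = Qp_of_rat p 1"
  by (simp add: Qp_def FactRing_def Qp_of_rat_def) (simp add: padic_Cauchy_ring_def)

lemma Qp_zero:
  assumes p: "prime p"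
  shows "\<zero>\<^bsub>Qp p\<^esub> = Qp_of_rat p 0"
proof -
  interpret I: ideal "padic_null p" "padic_Cauchy_ring p" by (rule padic_null_ideal[OF p])
  have "padic_null p +>\<^bsub>padic_Cauchy_ring p\<^esub> \<zero>\<^bsub>padic_Cauchy_ring p\<^esub> = padic_null p"
    by (rule I.a_rcos_zero[OF padic_null_ideal[OF p]]) auto
  thus ?thesis by (simp add: Qp_def FactRing_def Qp_of_rat_def) (simp add: padic_Cauchy_ring_def)
qed

lemma Qp_of_rat_carrier: "Qp_of_rat p q \<in> carrier (Qp p)"
  unfolding Qp_of_rat_def by (rule Qp_class_carrier[OF padic_Cauchy_const])

lemma Qp_of_rat_add:
  "prime p \<Longrightarrow> Qp_of_rat p (q + r) = Qp_of_rat p q \<oplus>\<^bsub>Qp p\<^esub> Qp_of_rat p r"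
  unfolding Qp_of_rat_def by (subst Qp_class_add) (auto intro: padic_Cauchy_const)

lemma Qp_of_rat_mult:
  "prime p \<Longrightarrow> Qp_of_rat p (q * r) = Qp_of_rat p q \<otimes>\<^bsub>Qp p\<^esub> Qp_of_rat p r"
  unfolding Qp_of_rat_def by (subst Qp_class_mult) (auto intro: padic_Cauchy_const)

lemma Qp_abs_class:
  assumes p: "prime p" and X: "padic_Cauchy p X" and r: "(\<lambda>n. padic_abs p (X n)) \<longlonglongrightarrow> r"
  shows "Qp_abs p (padic_null p +>\<^bsub>padic_Cauchy_ring p\<^esub> X) = r"
proof -
  interpret I: ideal "padic_null p" "padic_Cauchy_ring p" by (rule padic_null_ideal[OF p])
  have self: "X \<in> padic_null p +>\<^bsub>padic_Cauchy_ring p\<^esub> X"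
    using X by (intro I.a_rcos_self) (auto simp: padic_Cauchy_ring_def)
  have all: "(\<lambda>n. padic_abs p (Y n)) \<longlonglongrightarrow> r" if "Y \<in> padic_null p +>\<^bsub>padic_Cauchy_ring p\<^esub> X" for Y
  proof -
    obtain Z where Z: "Z \<in> padic_null p" "Y = (\<lambda>n. Z n + X n)"
      using \<open>Y \<in> _\<close> by (auto simp: a_r_coset_def' padic_Cauchy_ring_def)
    have "(\<lambda>n. padic_abs p (Y n) - padic_abs p (X n)) \<longlonglongrightarrow> 0"
    proof (rule Lim_null_comparison)
      show "(\<lambda>n. padic_abs p (Z n)) \<longlonglongrightarrow> 0" using Z by (simp add: padic_null_def)
      have "\<bar>padic_abs p (Y n) - padic_abs p (X n)\<bar> \<le> padic_abs p (Z n)" for n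
        using padic_abs_diff[OF p, of "Y n" "X n"] Z(2) by simp
      thus "\<forall>\<^sub>F n in sequentially. norm (padic_abs p (Y n) - padic_abs p (X n)) \<le> padic_abs p (Z n)"
        by simp
    qed
    from tendsto_add[OF this r] show ?thesis by simp
  qed
  show ?thesis
    unfolding Qp_abs_def using all self LIMSEQ_unique[OF _ r] by (intro the_equality) blast+
qed

lemma Qp_abs_of_rat: "prime p \<Longrightarrow> Qp_abs p (Qp_of_rat p q) = padic_abs p q"
  unfolding Qp_of_rat_def by (rule Qp_abs_class) (auto intro: padic_Cauchy_const)

lemma Zp_add:
  assumes p: "prime p" and "a \<in> Zp p" "b \<in> Zp p"
  shows "a \<oplus>\<^bsub>Qp p\<^esub> b \<in> Zp p"
proof -
  obtain X where X: "padic_Cauchy p X" "a = padic_null p +>\<^bsub>padic_Cauchy_ring p\<^esub> X"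
    using assms Qp_carrier_cases unfolding Zp_def by blast
  obtain Y where Y: "padic_Cauchy p Y" "b = padic_null p +>\<^bsub>padic_Cauchy_ring p\<^esub> Y"
    using assms Qp_carrier_cases unfolding Zp_def by blast
  have XY: "padic_Cauchy p (\<lambda>n. X n + Y n)" by (rule padic_Cauchy_add[OF p X(1) Y(1)])
  obtain r where r: "(\<lambda>n. padic_abs p (X n)) \<longlonglongrightarrow> r" using padic_Cauchy_lim[OF p X(1)] by blast
  obtain s where s: "(\<lambda>n. padic_abs p (Y n)) \<longlonglongrightarrow> s" using padic_Cauchy_lim[OF p Y(1)] by blast
  obtain t where t: "(\<lambda>n. padic_abs p (X n + Y n)) \<longlonglongrightarrow> t" using padic_Cauchy_lim[OF p XY] by blast
  have "r \<le> 1" "s \<le> 1" using assms(2,3) X Y Qp_abs_class[OF p] r s by (auto simp: Zp_def)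
  moreover have "t \<le> max r s"
    by (rule LIMSEQ_le[OF t tendsto_max[OF r s]]) (auto intro: padic_abs_add[OF p])
  ultimately have "t \<le> 1" by linarith
  thus ?thesis
    using X Y XY t by (simp add: Qp_class_add[OF p] Zp_def Qp_class_carrier Qp_abs_class[OF p])
qed

lemma Zp_mult:
  assumes p: "prime p" and "a \<in> Zp p" "b \<in> Zp p"
  shows "a \<otimes>\<^bsub>Qp p\<^esub> b \<in> Zp p"
proof -
  obtain X where X: "padic_Cauchy p X" "a = padic_null p +>\<^bsub>padic_Cauchy_ring p\<^esub> X"
    using assms Qp_carrier_cases unfolding Zp_def by blast
  obtain Y where Y: "padic_Cauchy p Y" "b = padic_null p +>\<^bsub>padic_Cauchy_ring p\<^esub> Y"
    using assms Qp_carrier_cases unfolding Zp_def by blast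
  have XY: "padic_Cauchy p (\<lambda>n. X n * Y n)" by (rule padic_Cauchy_mult[OF p X(1) Y(1)])
  obtain r where r: "(\<lambda>n. padic_abs p (X n)) \<longlonglongrightarrow> r" using padic_Cauchy_lim[OF p X(1)] by blast
  obtain s where s: "(\<lambda>n. padic_abs p (Y n)) \<longlonglongrightarrow> s" using padic_Cauchy_lim[OF p Y(1)] by blast
  have t: "(\<lambda>n. padic_abs p (X n * Y n)) \<longlonglongrightarrow> r * s"
    unfolding padic_abs_mult[OF p] by (rule tendsto_mult[OF r s])
  have rs: "r \<le> 1" "s \<le> 1" using assms(2,3) X Y Qp_abs_class[OF p] r s by (auto simp: Zp_def)
  have "s \<ge> 0" by (rule LIMSEQ_le_const[OF s]) auto
  hence "r * s \<le> 1" using rs by (meson mult_left_le_one_le mult_right_mono order_trans mult_1 order.refl)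
  thus ?thesis
    using X Y XY t by (simp add: Qp_class_mult[OF p] Zp_def Qp_class_carrier Qp_abs_class[OF p])
qed

lemma Zp_of_rat: "prime p \<Longrightarrow> padic_abs p q \<le> 1 \<Longrightarrow> Qp_of_rat p q \<in> Zp p"
  by (simp add: Zp_def Qp_of_rat_carrier Qp_abs_of_rat)

lemma Qp_uminus:
  assumes p: "prime p" and a: "a \<in> carrier (Qp p)"
  shows "\<ominus>\<^bsub>Qp p\<^esub> a = Qp_of_rat p (-1) \<otimes>\<^bsub>Qp p\<^esub> a"
proof -
  interpret cring "Qp p" by (rule Qp_cring[OF p])
  have "Qp_of_rat p (-1) \<oplus>\<^bsub>Qp p\<^esub> \<one>\<^bsub>Qp p\<^esub> = \<zero>\<^bsub>Qp p\<^esub>"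
    unfolding Qp_one Qp_zero[OF p] by (simp add: Qp_of_rat_add[OF p, symmetric])
  hence "\<ominus>\<^bsub>Qp p\<^esub> \<one>\<^bsub>Qp p\<^esub> = Qp_of_rat p (-1)"
    by (intro minus_equality) (auto simp: Qp_of_rat_carrier)
  thus ?thesis using a by (metis l_minus l_one one_closed)
qed

lemma Zp_uminus:
  assumes p: "prime p" and a: "a \<in> Zp p"
  shows "\<ominus>\<^bsub>Qp p\<^esub> a \<in> Zp p"
  using assms Zp_mult[OF p Zp_of_rat[OF p, of "-1"] a] by (subst Qp_uminus) (auto simp: Zp_def)

lemma Qp_class_diff:
  assumes p: "prime p" and X: "padic_Cauchy p X" and Y: "padic_Cauchy p Y"
  shows "(padic_null p +>\<^bsub>padic_Cauchy_ring p\<^esub> X) \<ominus>\<^bsub>Qp p\<^esub> (padic_null p +>\<^bsub>padic_Cauchy_ring p\<^esub> Y)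
    = padic_null p +>\<^bsub>padic_Cauchy_ring p\<^esub> (\<lambda>n. X n - Y n)"
proof -
  have "\<ominus>\<^bsub>Qp p\<^esub> (padic_null p +>\<^bsub>padic_Cauchy_ring p\<^esub> Y)
      = padic_null p +>\<^bsub>padic_Cauchy_ring p\<^esub> (\<lambda>n. - Y n)"
    by (subst Qp_uminus[OF p Qp_class_carrier[OF Y]])
      (simp add: Qp_of_rat_def Qp_class_mult[OF p padic_Cauchy_const Y])
  thus ?thesis
    by (simp add: a_minus_def Qp_class_add[OF p X padic_Cauchy_minus[OF Y]])
qed

lemma Qp_Metric_space:
  assumes p: "prime p"
  shows "Metric_space (carrier (Qp p)) (Qp_dist p)"
proof -
  interpret I: ideal "padic_null p" "padic_Cauchy_ring p" by (rule padic_null_ideal[OF p])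
  let ?c = "\<lambda>X. padic_null p +>\<^bsub>padic_Cauchy_ring p\<^esub> X"
  have lim: "(\<lambda>n. padic_abs p (X n - Y n)) \<longlonglongrightarrow> Qp_abs p (?c X \<ominus>\<^bsub>Qp p\<^esub> ?c Y)"
    if X: "padic_Cauchy p X" and Y: "padic_Cauchy p Y" for X Y
  proof -
    have XY: "padic_Cauchy p (\<lambda>n. X n - Y n)"
      using padic_Cauchy_add[OF p X padic_Cauchy_minus[OF Y]] by simp
    obtain r where r: "(\<lambda>n. padic_abs p (X n - Y n)) \<longlonglongrightarrow> r" using padic_Cauchy_lim[OF p XY] by blast
    show ?thesis using r by (simp add: Qp_class_diff[OF p X Y] Qp_abs_class[OF p XY r])
  qed
  have nonneg: "0 \<le> Qp_abs p (a \<ominus>\<^bsub>Qp p\<^esub> b)" if "a \<in> carrier (Qp p)" "b \<in> carrier (Qp p)" for a b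
  proof -
    obtain X where X: "padic_Cauchy p X" "a = ?c X" using Qp_carrier_cases \<open>a \<in> _\<close> by blast
    obtain Y where Y: "padic_Cauchy p Y" "b = ?c Y" using Qp_carrier_cases \<open>b \<in> _\<close> by blast
    show ?thesis unfolding X(2) Y(2) by (rule LIMSEQ_le_const[OF lim[OF X(1) Y(1)]]) simp
  qed
  have commute: "Qp_abs p (a \<ominus>\<^bsub>Qp p\<^esub> b) = Qp_abs p (b \<ominus>\<^bsub>Qp p\<^esub> a)"
    if "a \<in> carrier (Qp p)" "b \<in> carrier (Qp p)" for a b
  proof -
    obtain X where X: "padic_Cauchy p X" "a = ?c X" using Qp_carrier_cases \<open>a \<in> _\<close> by blast
    obtain Y where Y: "padic_Cauchy p Y" "b = ?c Y" using Qp_carrier_cases \<open>b \<in> _\<close> by blast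
    have "(\<lambda>n. padic_abs p (X n - Y n)) = (\<lambda>n. padic_abs p (Y n - X n))"
      by (simp add: padic_abs_diff_commute[of p "X _"])
    thus ?thesis
      unfolding X(2) Y(2) using lim[OF X(1) Y(1)] lim[OF Y(1) X(1)] LIMSEQ_unique by metis
  qed
  have zero: "Qp_abs p (a \<ominus>\<^bsub>Qp p\<^esub> b) = 0 \<longleftrightarrow> a = b"
    if "a \<in> carrier (Qp p)" "b \<in> carrier (Qp p)" for a b
  proof
    obtain X where X: "padic_Cauchy p X" "a = ?c X" using Qp_carrier_cases \<open>a \<in> _\<close> by blast
    obtain Y where Y: "padic_Cauchy p Y" "b = ?c Y" using Qp_carrier_cases \<open>b \<in> _\<close> by blast
    assume "Qp_abs p (a \<ominus>\<^bsub>Qp p\<^esub> b) = 0"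
    hence "(\<lambda>n. padic_abs p (X n - Y n)) \<longlonglongrightarrow> 0" using lim[OF X(1) Y(1)] X(2) Y(2) by simp
    hence "(\<lambda>n. X n - Y n) \<in> padic_null p"
      using padic_Cauchy_add[OF p X(1) padic_Cauchy_minus[OF Y(1)]] by (simp add: padic_null_def)
    hence "X \<in> ?c Y" by (auto simp: a_r_coset_def' padic_Cauchy_ring_def intro!: bexI[of _ "\<lambda>n. X n - Y n"])
    moreover have "Y \<in> carrier (padic_Cauchy_ring p)" using Y(1) by (simp add: padic_Cauchy_ring_def)
    ultimately have "?c Y = ?c X" using I.a_subgroup by (rule I.a_repr_independence)
    thus "a = b" using X(2) Y(2) by simp
  next
    obtain X where X: "padic_Cauchy p X" "a = ?c X" using Qp_carrier_cases \<open>a \<in> _\<close> by blast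
    assume "a = b"
    thus "Qp_abs p (a \<ominus>\<^bsub>Qp p\<^esub> b) = 0"
      using lim[OF X(1) X(1)] X(2) by (simp add: LIMSEQ_const_iff)
  qed
  have triangle: "Qp_abs p (a \<ominus>\<^bsub>Qp p\<^esub> c) \<le> Qp_abs p (a \<ominus>\<^bsub>Qp p\<^esub> b) + Qp_abs p (b \<ominus>\<^bsub>Qp p\<^esub> c)"
    if "a \<in> carrier (Qp p)" "b \<in> carrier (Qp p)" "c \<in> carrier (Qp p)" for a b c
  proof -
    obtain X where X: "padic_Cauchy p X" "a = ?c X" using Qp_carrier_cases \<open>a \<in> _\<close> by blast
    obtain Y where Y: "padic_Cauchy p Y" "b = ?c Y" using Qp_carrier_cases \<open>b \<in> _\<close> by blast
    obtain Z where Z: "padic_Cauchy p Z" "c = ?c Z" using Qp_carrier_cases \<open>c \<in> _\<close> by blast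
    have "padic_abs p (X n - Z n) \<le> padic_abs p (X n - Y n) + padic_abs p (Y n - Z n)" for n
      using padic_abs_add_le[OF p, of "X n - Y n" "Y n - Z n"] by simp
    thus ?thesis
      unfolding X(2) Y(2) Z(2)
      by (intro LIMSEQ_le[OF lim[OF X(1) Z(1)] tendsto_add[OF lim[OF X(1) Y(1)] lim[OF Y(1) Z(1)]]]) auto
  qed
  show ?thesis
    unfolding Qp_dist_def by unfold_locales (use nonneg commute zero triangle in simp_all)
qed

lemma padic_abs_le_1_cofinite: "finite {p. prime p \<and> padic_abs p q > 1}"
proof (cases "q = 0")
  case False
  let ?d = "snd (quotient_of q)"
  have d: "?d > 0" by (rule quotient_of_denom_pos')
  have "{p. prime p \<and> padic_abs p q > 1} \<subseteq> {p. p dvd nat ?d}"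
  proof clarsimp
    fix p assume p: "prime p" and gt: "1 < padic_abs p q"
    have p1: "real p > 1" using p prime_gt_1_nat by auto
    show "p dvd nat ?d"
    proof (rule ccontr)
      assume "\<not> p dvd nat ?d"
      hence "\<not> int p dvd ?d" using d by (metis int_dvd_int_iff int_nat_eq less_imp_le)
      hence "multiplicity (int p) ?d = 0" by (rule not_dvd_imp_multiplicity_0)
      hence "padic_abs p q \<le> real p powi 0"
        unfolding padic_abs_def using False p1
        by (simp only: if_False) (rule power_int_increasing, auto)
      thus False using gt by simp
    qed
  qed
  moreover have "finite {p. p dvd nat ?d}" using d by auto
  ultimately show ?thesis using finite_subset by blast
qed auto


section \<open>Adeles\<close>

text \<open>
  The finite adeles are the restricted product of the fields \<open>\<rat>\<^sub>p\<close> with respect to the subrings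
  \<open>\<int>\<^sub>p\<close>, with the restricted product topology.
\<close>

definition restricted_product :: "(nat \<Rightarrow> (nat \<Rightarrow> rat) set) set" where
  "restricted_product =
     {x \<in> (\<Pi>\<^sub>E p\<in>{p. prime p}. carrier (Qp p)). finite {p. prime p \<and> x p \<notin> Zp p}}"

lemma restricted_productI:
  assumes "\<And>p. prime p \<Longrightarrow> f p \<in> carrier (Qp p)" and "finite {p. prime p \<and> f p \<notin> Zp p}"
  shows "(\<lambda>p\<in>{p. prime p}. f p) \<in> restricted_product"
proof -
  have "{p. prime p \<and> (\<lambda>p\<in>{p. prime p}. f p) p \<notin> Zp p} = {p. prime p \<and> f p \<notin> Zp p}"
    by (intro Collect_cong conj_cong refl) simp
  moreover have "(\<lambda>p\<in>{p. prime p}. f p) \<in> (\<Pi>\<^sub>E p\<in>{p. prime p}. carrier (Qp p))"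
    using assms(1) by (intro restrict_PiE_iff[THEN iffD2] ballI) simp
  ultimately show ?thesis
    unfolding restricted_product_def using assms(2) by (intro CollectI conjI) simp_all
qed

lemma restricted_product_carrier: "x \<in> restricted_product \<Longrightarrow> prime p \<Longrightarrow> x p \<in> carrier (Qp p)"
  unfolding restricted_product_def by (drule CollectD, drule conjunct1, erule PiE_mem) (rule CollectI)

lemma restricted_product_finite: "x \<in> restricted_product \<Longrightarrow> finite {p. prime p \<and> x p \<notin> Zp p}"
  unfolding restricted_product_def by (drule CollectD, erule conjunct2)

lemma restricted_product_of_rat: "(\<lambda>p\<in>{p. prime p}. Qp_of_rat p q) \<in> restricted_product"
proof (rule restricted_productI)
  have "{p. prime p \<and> Qp_of_rat p q \<notin> Zp p} \<subseteq> {p. prime p \<and> padic_abs p q > 1}"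
    using Zp_of_rat[of _ q] by (intro Collect_mono impI) (metis not_le)
  thus "finite {p. prime p \<and> Qp_of_rat p q \<notin> Zp p}"
    using padic_abs_le_1_cofinite by (rule finite_subset)
qed (rule Qp_of_rat_carrier)

lemma restricted_product_add:
  assumes x: "x \<in> restricted_product" and y: "y \<in> restricted_product"
  shows "(\<lambda>p\<in>{p. prime p}. x p \<oplus>\<^bsub>Qp p\<^esub> y p) \<in> restricted_product"
proof (rule restricted_productI)
  have "{p. prime p \<and> x p \<oplus>\<^bsub>Qp p\<^esub> y p \<notin> Zp p}
     \<subseteq> {p. prime p \<and> x p \<notin> Zp p} \<union> {p. prime p \<and> y p \<notin> Zp p}"
    by (intro subsetI) (use Zp_add in \<open>simp only: mem_Collect_eq Un_iff, metis\<close>)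
  thus "finite {p. prime p \<and> x p \<oplus>\<^bsub>Qp p\<^esub> y p \<notin> Zp p}"
    by (rule finite_subset) (intro finite_UnI restricted_product_finite x y)
qed (intro Qp_add_closed restricted_product_carrier[OF x] restricted_product_carrier[OF y]; assumption)

lemma restricted_product_mult:
  assumes x: "x \<in> restricted_product" and y: "y \<in> restricted_product"
  shows "(\<lambda>p\<in>{p. prime p}. x p \<otimes>\<^bsub>Qp p\<^esub> y p) \<in> restricted_product"
proof (rule restricted_productI)
  have "{p. prime p \<and> x p \<otimes>\<^bsub>Qp p\<^esub> y p \<notin> Zp p}
     \<subseteq> {p. prime p \<and> x p \<notin> Zp p} \<union> {p. prime p \<and> y p \<notin> Zp p}"
    by (intro subsetI) (use Zp_mult in \<open>simp only: mem_Collect_eq Un_iff, metis\<close>)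
  thus "finite {p. prime p \<and> x p \<otimes>\<^bsub>Qp p\<^esub> y p \<notin> Zp p}"
    by (rule finite_subset) (intro finite_UnI restricted_product_finite x y)
qed (intro Qp_mult_closed restricted_product_carrier[OF x] restricted_product_carrier[OF y]; assumption)

lemma restricted_product_uminus:
  assumes x: "x \<in> restricted_product"
  shows "(\<lambda>p\<in>{p. prime p}. \<ominus>\<^bsub>Qp p\<^esub> x p) \<in> restricted_product"
proof (rule restricted_productI)
  have "{p. prime p \<and> \<ominus>\<^bsub>Qp p\<^esub> x p \<notin> Zp p} \<subseteq> {p. prime p \<and> x p \<notin> Zp p}"
    by (intro subsetI) (use Zp_uminus in \<open>simp only: mem_Collect_eq, metis\<close>)
  thus "finite {p. prime p \<and> \<ominus>\<^bsub>Qp p\<^esub> x p \<notin> Zp p}"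
    by (rule finite_subset) (rule restricted_product_finite[OF x])
qed (intro Qp_uminus_closed restricted_product_carrier[OF x]; assumption)

typedef finite_adele = restricted_product
  morphisms fa_component Abs_finite_adele
  using restricted_product_of_rat by blast

setup_lifting type_definition_finite_adele

lift_definition fa_of_rat :: "rat \<Rightarrow> finite_adele" is "\<lambda>q. \<lambda>p\<in>{p. prime p}. Qp_of_rat p q"
  by (rule restricted_product_of_rat)

instantiation finite_adele :: comm_ring_1
begin

definition zero_finite_adele :: finite_adele where "0 = fa_of_rat 0"

definition one_finite_adele :: finite_adele where "1 = fa_of_rat 1"

lift_definition plus_finite_adele :: "finite_adele \<Rightarrow> finite_adele \<Rightarrow> finite_adele"
  is "\<lambda>x y. \<lambda>p\<in>{p. prime p}. x p \<oplus>\<^bsub>Qp p\<^esub> y p"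
  by (rule restricted_product_add)

lift_definition times_finite_adele :: "finite_adele \<Rightarrow> finite_adele \<Rightarrow> finite_adele"
  is "\<lambda>x y. \<lambda>p\<in>{p. prime p}. x p \<otimes>\<^bsub>Qp p\<^esub> y p"
  by (rule restricted_product_mult)

lift_definition uminus_finite_adele :: "finite_adele \<Rightarrow> finite_adele"
  is "\<lambda>x. \<lambda>p\<in>{p. prime p}. \<ominus>\<^bsub>Qp p\<^esub> x p"
  by (rule restricted_product_uminus)

definition minus_finite_adele :: "finite_adele \<Rightarrow> finite_adele \<Rightarrow> finite_adele"
  where "x - y = x + (- y)" for x y :: finite_adele

lemma fa_component_carrier: "prime p \<Longrightarrow> fa_component x p \<in> carrier (Qp p)"
  by (rule restricted_product_carrier[OF fa_component])

lemma fa_eqI: "(\<And>p. prime p \<Longrightarrow> fa_component x p = fa_component y p) \<Longrightarrow> x = y"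
proof -
  assume *: "\<And>p. prime p \<Longrightarrow> fa_component x p = fa_component y p"
  have "fa_component x \<in> (\<Pi>\<^sub>E p\<in>{p. prime p}. carrier (Qp p))"
    "fa_component y \<in> (\<Pi>\<^sub>E p\<in>{p. prime p}. carrier (Qp p))"
    using fa_component[of x] fa_component[of y] unfolding restricted_product_def by blast+
  hence "fa_component x = fa_component y" by (rule PiE_ext) (use * in blast)
  thus ?thesis by (simp only: fa_component_inject)
qed

lemma fa_component_of_rat: "prime p \<Longrightarrow> fa_component (fa_of_rat q) p = Qp_of_rat p q"
  by (simp add: fa_of_rat.rep_eq)

lemma fa_component_zero: "prime p \<Longrightarrow> fa_component 0 p = \<zero>\<^bsub>Qp p\<^esub>"
  by (simp add: zero_finite_adele_def fa_component_of_rat Qp_zero)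

lemma fa_component_one: "prime p \<Longrightarrow> fa_component 1 p = \<one>\<^bsub>Qp p\<^esub>"
  by (simp add: one_finite_adele_def fa_component_of_rat Qp_one)

lemma fa_component_plus:
  "prime p \<Longrightarrow> fa_component (x + y) p = fa_component x p \<oplus>\<^bsub>Qp p\<^esub> fa_component y p"
  by (simp add: plus_finite_adele.rep_eq)

lemma fa_component_times:
  "prime p \<Longrightarrow> fa_component (x * y) p = fa_component x p \<otimes>\<^bsub>Qp p\<^esub> fa_component y p"
  by (simp add: times_finite_adele.rep_eq)

lemma fa_component_uminus:
  "prime p \<Longrightarrow> fa_component (- x) p = \<ominus>\<^bsub>Qp p\<^esub> fa_component x p"
  by (simp add: uminus_finite_adele.rep_eq)

lemmas fa_component_simps =
  fa_component_zero fa_component_one fa_component_plus fa_component_times fa_component_uminus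

instance
proof
  fix a b c :: finite_adele
  note [simp] = fa_component_simps fa_component_carrier
  show "a + b + c = a + (b + c)"
  proof (rule fa_eqI)
    fix p :: nat assume p: "prime p"
    interpret cring "Qp p" by (rule Qp_cring[OF p])
    show "fa_component (a + b + c) p = fa_component (a + (b + c)) p" using p by (simp add: a_assoc)
  qed
  show "a + b = b + a"
  proof (rule fa_eqI)
    fix p :: nat assume p: "prime p"
    interpret cring "Qp p" by (rule Qp_cring[OF p])
    show "fa_component (a + b) p = fa_component (b + a) p" using p by (simp add: a_comm)
  qed
  show "0 + a = a"
  proof (rule fa_eqI)
    fix p :: nat assume p: "prime p"
    interpret cring "Qp p" by (rule Qp_cring[OF p])
    show "fa_component (0 + a) p = fa_component a p" using p by simp
  qed
  show "- a + a = 0"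
  proof (rule fa_eqI)
    fix p :: nat assume p: "prime p"
    interpret cring "Qp p" by (rule Qp_cring[OF p])
    show "fa_component (- a + a) p = fa_component 0 p" using p by (simp add: l_neg)
  qed
  show "a - b = a + - b" by (simp add: minus_finite_adele_def)
  show "a * b * c = a * (b * c)"
  proof (rule fa_eqI)
    fix p :: nat assume p: "prime p"
    interpret cring "Qp p" by (rule Qp_cring[OF p])
    show "fa_component (a * b * c) p = fa_component (a * (b * c)) p" using p by (simp add: m_assoc)
  qed
  show "a * b = b * a"
  proof (rule fa_eqI)
    fix p :: nat assume p: "prime p"
    interpret cring "Qp p" by (rule Qp_cring[OF p])
    show "fa_component (a * b) p = fa_component (b * a) p" using p by (simp add: m_comm)
  qed
  show "1 * a = a"
  proof (rule fa_eqI)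
    fix p :: nat assume p: "prime p"
    interpret cring "Qp p" by (rule Qp_cring[OF p])
    show "fa_component (1 * a) p = fa_component a p" using p by simp
  qed
  show "(a + b) * c = a * c + b * c"
  proof (rule fa_eqI)
    fix p :: nat assume p: "prime p"
    interpret cring "Qp p" by (rule Qp_cring[OF p])
    show "fa_component ((a + b) * c) p = fa_component (a * c + b * c) p"
      using p by (simp add: l_distr)
  qed
  show "(0::finite_adele) \<noteq> 1"
  proof
    assume "(0::finite_adele) = 1"
    hence "fa_component (fa_of_rat 0) 2 = fa_component (fa_of_rat 1) 2"
      by (simp add: zero_finite_adele_def one_finite_adele_def)
    hence "Qp_abs 2 (Qp_of_rat 2 0) = Qp_abs 2 (Qp_of_rat 2 1)"
      by (simp only: fa_component_of_rat[OF two_is_prime_nat])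
    thus False by (simp add: Qp_abs_of_rat[OF two_is_prime_nat])
  qed
qed

end

lemma fa_of_rat_add: "fa_of_rat (q + r) = fa_of_rat q + fa_of_rat r"
  by (rule fa_eqI) (simp add: fa_component_of_rat fa_component_plus Qp_of_rat_add)

lemma fa_of_rat_mult: "fa_of_rat (q * r) = fa_of_rat q * fa_of_rat r"
  by (rule fa_eqI) (simp add: fa_component_of_rat fa_component_times Qp_of_rat_mult)

instantiation finite_adele :: topological_space
begin

definition open_finite_adele :: "finite_adele set \<Rightarrow> bool" where
  "open_finite_adele = generate_topology
     {{x. \<forall>p. prime p \<longrightarrow> fa_component x p \<in> U p} | U.
        (\<forall>p. prime p \<longrightarrow> openin (Qp_topology p) (U p)) \<and> finite {p. prime p \<and> U p \<noteq> Zp p}}"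

instance
  by standard (auto simp: open_finite_adele_def intro: generate_topology.intros)

end

instantiation prod :: (comm_ring_1, comm_ring_1) comm_ring_1
begin

definition one_prod :: "'a \<times> 'b" where "1 = (1, 1)"

definition times_prod :: "'a \<times> 'b \<Rightarrow> 'a \<times> 'b \<Rightarrow> 'a \<times> 'b" where
  "x * y = (fst x * fst y, snd x * snd y)"

instance
  by standard (auto simp: one_prod_def times_prod_def algebra_simps zero_prod_def)

end

text \<open>
  The topology on \<open>adele\<close>, and on matrices over it, is the product topology of the library
  instances for pairs and \<^typ>\<open>'a^'n\<close>.
\<close>

type_synonym adele = "finite_adele \<times> real"

definition adele_of_rat :: "rat \<Rightarrow> adele" where
  "adele_of_rat q = (fa_of_rat q, of_rat q)"

definition Zhat :: "finite_adele set" where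
  "Zhat = {x. \<forall>p. prime p \<longrightarrow> fa_component x p \<in> Zp p}"

definition Zhat_units :: "finite_adele set" where
  "Zhat_units = {u \<in> Zhat. \<exists>v\<in>Zhat. u * v = 1}"

text \<open>The idele with finite component \<open>u\<close> and archimedean component \<open>1\<close>.\<close>

definition adele_of_Zhat :: "finite_adele \<Rightarrow> adele" where
  "adele_of_Zhat u = (u, 1)"


section \<open>The affine group and its actions\<close>

text \<open>
  For a commutative ring \<open>R\<close>, \<open>affmat a b\<close> is the matrix with rows \<open>(a, b)\<close> and \<open>(0, 1)\<close>; the
  units of \<open>R\<close> are the divisors of \<open>1\<close>.
\<close>

definition affmat :: "'a \<Rightarrow> 'a \<Rightarrow> 'a::comm_ring_1^2^2" where
  "affmat a b = vector [vector [a, b], vector [0, 1]]"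

definition Pbar :: "('a::comm_ring_1^2^2) set" where
  "Pbar = {affmat a b | a b. True}"

definition P_group :: "('a::comm_ring_1^2^2) monoid" where
  "P_group = \<lparr>carrier = {affmat a b | a b. a dvd 1}, mult = (**), one = mat 1\<rparr>"

definition GL1_group :: "('a::comm_ring_1^2^2) monoid" where
  "GL1_group = \<lparr>carrier = {affmat a 0 | a. a dvd 1}, mult = (**), one = mat 1\<rparr>"

definition iota :: "'a \<times> 'a \<Rightarrow> 'a::comm_ring_1^2^2" where
  "iota = (\<lambda>(x, y). affmat y x)"

definition PQ_act_A2 :: "rat^2^2 \<Rightarrow> adele \<times> adele \<Rightarrow> adele \<times> adele" where
  "PQ_act_A2 g = (\<lambda>(x, y). (adele_of_rat (g$1$1) * x + adele_of_rat (g$1$2), adele_of_rat (g$1$1) * y))"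

definition PQ_act_Pbar :: "rat^2^2 \<Rightarrow> adele^2^2 \<Rightarrow> adele^2^2" where
  "PQ_act_Pbar g = (\<lambda>m\<in>Pbar. map_matrix adele_of_rat g ** m)"

definition C_Q :: "(adele \<times> adele) set set" where
  "C_Q = orbits P_group UNIV PQ_act_A2"

definition PQ_Pbar :: "(adele^2^2) set set" where
  "PQ_Pbar = orbits P_group Pbar PQ_act_Pbar"

text \<open>By equivariance of \<^const>\<open>iota\<close>, the map it induces on orbits is the image map.\<close>

definition j_map :: "(adele \<times> adele) set \<Rightarrow> (adele^2^2) set" where
  "j_map C = iota ` C"

text \<open>
  The actions of \<open>Zhat_units\<close>, \<open>K_Zhat\<close> and \<open>P(\<real>)\<close> commute with that of \<open>P(\<rat>)\<close>, so they descend to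
  \<open>P(\<rat>)\<close>-orbits, where they act by taking images of orbits.
\<close>

definition Zhat_units_group :: "finite_adele monoid" where
  "Zhat_units_group = \<lparr>carrier = Zhat_units, mult = (*), one = 1\<rparr>"

definition Zhat_act_A2 :: "finite_adele \<Rightarrow> adele \<times> adele \<Rightarrow> adele \<times> adele" where
  "Zhat_act_A2 u = (\<lambda>(x, y). (x, adele_of_Zhat u * y))"

definition Zhat_act_C :: "finite_adele \<Rightarrow> (adele \<times> adele) set \<Rightarrow> (adele \<times> adele) set" where
  "Zhat_act_C u = (\<lambda>C\<in>C_Q. Zhat_act_A2 u ` C)"

definition Gamma_Q :: "(adele \<times> adele) set set set" where
  "Gamma_Q = orbits Zhat_units_group C_Q Zhat_act_C"

definition K_Zhat :: "(adele^2^2) set" where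
  "K_Zhat = {affmat (adele_of_Zhat u) 0 | u. u \<in> Zhat_units}"

definition K_group :: "(adele^2^2) monoid" where
  "K_group = GL1_group\<lparr>carrier := K_Zhat\<rparr>"

text \<open>Since \<open>K_Zhat\<close> is commutative, its action by right multiplication is also a left action.\<close>

definition K_act :: "adele^2^2 \<Rightarrow> (adele^2^2) set \<Rightarrow> (adele^2^2) set" where
  "K_act k = (\<lambda>D\<in>PQ_Pbar. (\<lambda>m. m ** k) ` D)"

definition PQ_Pbar_K :: "(adele^2^2) set set set" where
  "PQ_Pbar_K = orbits K_group PQ_Pbar K_act"

text \<open>
  The embedding of \<open>P(\<real>)\<close> into the adelic points at the archimedean place: the finite component
  is the identity matrix.
\<close>

definition PR_emb :: "real^2^2 \<Rightarrow> adele^2^2" where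
  "PR_emb g = (\<chi> i j. (mat 1 $ i $ j, g $ i $ j))"

definition PR_act :: "(adele^2^2) set \<Rightarrow> real^2^2 \<Rightarrow> (adele^2^2) set" where
  "PR_act D g = (\<lambda>m. m ** PR_emb g) ` D"

definition V_quot :: "(adele^2^2) set set" where
  "V_quot = {orbit P_group PQ_act_Pbar (affmat y x) | x y. fst y \<noteq> 0 \<and> snd y \<noteq> 0}"

definition quotient_topology :: "'a topology \<Rightarrow> ('a \<Rightarrow> 'b) \<Rightarrow> 'b topology" where
  "quotient_topology X f =
     topology (\<lambda>U. U \<subseteq> f ` topspace X \<and> openin X {x \<in> topspace X. f x \<in> U})"

definition PQ_Pbar_topology :: "(adele^2^2) set topology" where
  "PQ_Pbar_topology = quotient_topology (top_of_set Pbar) (orbit P_group PQ_act_Pbar)"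

lemma quotient_map_quotient_topology: "quotient_map X (quotient_topology X f) f"
proof -
  let ?P = "\<lambda>U. U \<subseteq> f ` topspace X \<and> openin X {x \<in> topspace X. f x \<in> U}"
  have "istopology ?P"
    unfolding istopology_def
  proof (intro conjI allI impI)
    fix S T assume S: "?P S" and T: "?P T"
    show "S \<inter> T \<subseteq> f ` topspace X" using S by blast
    have "{x \<in> topspace X. f x \<in> S \<inter> T} = {x \<in> topspace X. f x \<in> S} \<inter> {x \<in> topspace X. f x \<in> T}"
      by blast
    thus "openin X {x \<in> topspace X. f x \<in> S \<inter> T}" using S T by auto
  next
    fix \<K> assume K: "\<forall>K\<in>\<K>. ?P K"
    show "\<Union>\<K> \<subseteq> f ` topspace X" using K by blast
    have "{x \<in> topspace X. f x \<in> \<Union>\<K>} = (\<Union>K\<in>\<K>. {x \<in> topspace X. f x \<in> K})" by blast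
    thus "openin X {x \<in> topspace X. f x \<in> \<Union>\<K>}" using K by auto
  qed
  hence *: "openin (quotient_topology X f) U \<longleftrightarrow> ?P U" for U
    by (simp add: quotient_topology_def topology_inverse')
  have "{x \<in> topspace X. f x \<in> f ` topspace X} = topspace X" by blast
  hence "openin (quotient_topology X f) (f ` topspace X)" by (simp add: *)
  hence "topspace (quotient_topology X f) = f ` topspace X"
    by (metis * openin_subset openin_topspace subset_antisym)
  thus ?thesis unfolding quotient_map_def * by auto
qed



section \<open>The actions are well defined\<close>

lemma affmat_nth [simp]:
  "affmat a b $ 1 $ 1 = a" "affmat a b $ 1 $ 2 = b" "affmat a b $ 2 $ 1 = 0" "affmat a b $ 2 $ 2 = 1"
  by (simp_all add: affmat_def)

lemma affmat_eq_iff [simp]: "affmat a b = affmat c d \<longleftrightarrow> a = c \<and> b = d"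
  by (metis affmat_nth(1,2))

lemma matrix2_eqI:
  "m $ 1 $ 1 = n $ 1 $ 1 \<Longrightarrow> m $ 1 $ 2 = n $ 1 $ 2 \<Longrightarrow> m $ 2 $ 1 = n $ 2 $ 1 \<Longrightarrow> m $ 2 $ 2 = n $ 2 $ 2
    \<Longrightarrow> m = (n :: 'a^2^2)"
  by (simp add: vec_eq_iff forall_2)

lemma affmat_mult [simp]: "affmat a b ** affmat c d = affmat (a * c) (a * d + b)"
  by (rule matrix2_eqI) (simp_all add: matrix_matrix_mult_def sum_2)

lemma mat_1_affmat: "mat 1 = affmat 1 0"
  by (rule matrix2_eqI) (simp_all add: mat_def)

lemma affmat_in_Pbar [simp]: "affmat a b \<in> Pbar"
  by (auto simp: Pbar_def)

lemma adele_of_rat_simps [simp]: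
  "adele_of_rat 0 = 0" "adele_of_rat 1 = 1"
  "adele_of_rat (q + r) = adele_of_rat q + adele_of_rat r"
  "adele_of_rat (q * r) = adele_of_rat q * adele_of_rat r"
  by (simp_all add: adele_of_rat_def zero_prod_def one_prod_def times_prod_def fa_of_rat_add
      fa_of_rat_mult zero_finite_adele_def one_finite_adele_def of_rat_add of_rat_mult)

lemma map_matrix_affmat [simp]:
  "map_matrix adele_of_rat (affmat a b) = affmat (adele_of_rat a) (adele_of_rat b)"
  by (rule matrix2_eqI) simp_all

lemma PR_emb_affmat [simp]: "PR_emb (affmat a b) = affmat (1, a) (0, b)"
  by (rule matrix2_eqI) (simp_all add: PR_emb_def mat_def zero_prod_def one_prod_def)

lemma P_group_group: "group (P_group :: ('a::comm_ring_1^2^2) monoid)"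
proof (rule groupI)
  fix x :: "'a^2^2" assume "x \<in> carrier P_group"
  then obtain a b where x: "x = affmat a b" "a dvd 1" by (auto simp: P_group_def)
  then obtain c where c: "a * c = 1" by (metis dvdE)
  have "affmat c (- c * b) \<otimes>\<^bsub>P_group\<^esub> x = \<one>\<^bsub>P_group\<^esub>"
    using c by (simp add: x P_group_def mat_1_affmat mult.commute)
  moreover have "affmat c (- c * b) \<in> carrier P_group"
    using c by (auto simp: P_group_def intro!: dvdI[of 1 c a] simp: mult.commute)
  ultimately show "\<exists>y\<in>carrier P_group. y \<otimes>\<^bsub>P_group\<^esub> x = \<one>\<^bsub>P_group\<^esub>" by blast
next
  fix x y :: "'a^2^2" assume "x \<in> carrier P_group" "y \<in> carrier P_group"
  thus "x \<otimes>\<^bsub>P_group\<^esub> y \<in> carrier P_group"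
    by (auto simp: P_group_def) (metis mult_dvd_mono mult_1)
qed (auto simp: P_group_def mat_1_affmat algebra_simps)

lemma group_actionI:
  assumes G: "group G"
    and ext: "\<And>g. g \<in> carrier G \<Longrightarrow> \<phi> g \<in> extensional E"
    and closed: "\<And>g x. g \<in> carrier G \<Longrightarrow> x \<in> E \<Longrightarrow> \<phi> g x \<in> E"
    and one: "\<And>x. x \<in> E \<Longrightarrow> \<phi> \<one>\<^bsub>G\<^esub> x = x"
    and mult: "\<And>g h x. g \<in> carrier G \<Longrightarrow> h \<in> carrier G \<Longrightarrow> x \<in> E \<Longrightarrow> \<phi> (g \<otimes>\<^bsub>G\<^esub> h) x = \<phi> g (\<phi> h x)"
  shows "group_action G E \<phi>"
proof -
  interpret group G by (rule G)
  have bij: "\<phi> g \<in> Bij E" if g: "g \<in> carrier G" for g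
  proof -
    have "bij_betw (\<phi> g) E E"
    proof (rule bij_betwI[where g = "\<phi> (inv\<^bsub>G\<^esub> g)"])
      show "\<phi> g \<in> E \<rightarrow> E" "\<phi> (inv\<^bsub>G\<^esub> g) \<in> E \<rightarrow> E" using g closed by auto
      show "\<phi> (inv\<^bsub>G\<^esub> g) (\<phi> g x) = x" if "x \<in> E" for x
        using mult[of "inv\<^bsub>G\<^esub> g" g x] one[of x] g that by simp
      show "\<phi> g (\<phi> (inv\<^bsub>G\<^esub> g) x) = x" if "x \<in> E" for x
        using mult[of g "inv\<^bsub>G\<^esub> g" x] one[of x] g that by simp
    qed
    thus ?thesis using ext[OF g] by (simp add: Bij_def)
  qed
  have "\<phi> \<in> hom G (BijGroup E)"
  proof (rule homI)
    fix g h assume g: "g \<in> carrier G" and h: "h \<in> carrier G"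
    show "\<phi> (g \<otimes>\<^bsub>G\<^esub> h) = \<phi> g \<otimes>\<^bsub>BijGroup E\<^esub> \<phi> h"
    proof (rule extensionalityI[of _ E])
      show "\<phi> (g \<otimes>\<^bsub>G\<^esub> h) \<in> extensional E" using g h ext by simp
      show "\<phi> g \<otimes>\<^bsub>BijGroup E\<^esub> \<phi> h \<in> extensional E" using bij g h by (simp add: BijGroup_def)
      show "\<phi> (g \<otimes>\<^bsub>G\<^esub> h) x = (\<phi> g \<otimes>\<^bsub>BijGroup E\<^esub> \<phi> h) x" if "x \<in> E" for x
        using bij g h that mult by (simp add: BijGroup_def compose_def)
    qed
  qed (simp add: BijGroup_def bij)
  thus ?thesis
    by (intro group_action.intro group_hom.intro group_hom_axioms.intro G group_BijGroup)
qed

lemma image_orbit: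
  assumes "\<And>g. g \<in> carrier G \<Longrightarrow> f (\<phi> g x) = \<phi>' g (f x)"
  shows "f ` orbit G \<phi> x = orbit G \<phi>' (f x)"
  unfolding orbit_def using assms by force

lemma quotient_group_action:
  assumes G: "group_action G E \<phi>" and H: "group H"
    and closed: "\<And>h x. h \<in> carrier H \<Longrightarrow> x \<in> E \<Longrightarrow> \<psi> h x \<in> E"
    and one: "\<And>x. x \<in> E \<Longrightarrow> \<psi> \<one>\<^bsub>H\<^esub> x = x"
    and mult: "\<And>h k x. h \<in> carrier H \<Longrightarrow> k \<in> carrier H \<Longrightarrow> x \<in> E \<Longrightarrow> \<psi> (h \<otimes>\<^bsub>H\<^esub> k) x = \<psi> h (\<psi> k x)"
    and commutes: "\<And>g h x. g \<in> carrier G \<Longrightarrow> h \<in> carrier H \<Longrightarrow> x \<in> E \<Longrightarrow> \<psi> h (\<phi> g x) = \<phi> g (\<psi> h x)"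
  shows "group_action H (orbits G E \<phi>) (\<lambda>h. \<lambda>C\<in>orbits G E \<phi>. \<psi> h ` C)"
proof -
  interpret H: group H by (rule H)
  interpret G: group_action G E \<phi> by (rule G)
  have img: "\<psi> h ` orbit G \<phi> x = orbit G \<phi> (\<psi> h x)" if "h \<in> carrier H" "x \<in> E" for h x
    by (rule image_orbit) (use that commutes in auto)
  show ?thesis
  proof (rule group_actionI[OF H])
    show clos: "(\<lambda>C\<in>orbits G E \<phi>. \<psi> h ` C) C \<in> orbits G E \<phi>"
      if "h \<in> carrier H" "C \<in> orbits G E \<phi>" for h C
      using that img closed by (fastforce simp: orbits_def)
    show "(\<lambda>C\<in>orbits G E \<phi>. \<psi> \<one>\<^bsub>H\<^esub> ` C) C = C" if C: "C \<in> orbits G E \<phi>" for C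
    proof -
      obtain x where x: "x \<in> E" "C = orbit G \<phi> x" using C by (auto simp: orbits_def)
      hence "\<psi> \<one>\<^bsub>H\<^esub> ` C = C" by (simp add: img one)
      thus ?thesis using C by simp
    qed
    show "(\<lambda>C\<in>orbits G E \<phi>. \<psi> (h \<otimes>\<^bsub>H\<^esub> k) ` C) C
        = (\<lambda>C\<in>orbits G E \<phi>. \<psi> h ` C) ((\<lambda>C\<in>orbits G E \<phi>. \<psi> k ` C) C)"
      if h: "h \<in> carrier H" and k: "k \<in> carrier H" and C: "C \<in> orbits G E \<phi>" for h k C
    proof -
      obtain x where x: "x \<in> E" "C = orbit G \<phi> x" using C by (auto simp: orbits_def)
      have "\<psi> (h \<otimes>\<^bsub>H\<^esub> k) ` C = \<psi> h ` (\<psi> k ` C)"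
        using x h k by (simp add: img closed mult)
      moreover have "\<psi> k ` C \<in> orbits G E \<phi>" using clos[OF k C] C by simp
      ultimately show ?thesis using C by simp
    qed
  qed simp
qed

lemma PQ_act_A2_group_action: "group_action P_group UNIV PQ_act_A2"
  by (rule group_actionI[OF P_group_group])
    (auto simp: PQ_act_A2_def P_group_def mat_1_affmat algebra_simps)

lemma PQ_act_Pbar_affmat [simp]:
  "PQ_act_Pbar (affmat a b) (affmat y x) = affmat (adele_of_rat a * y) (adele_of_rat a * x + adele_of_rat b)"
  by (simp add: PQ_act_Pbar_def)

lemma PQ_act_Pbar_group_action: "group_action P_group Pbar PQ_act_Pbar"
proof (rule group_actionI[OF P_group_group])
  show "PQ_act_Pbar g \<in> extensional Pbar" for g by (simp add: PQ_act_Pbar_def)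
qed (auto simp: P_group_def Pbar_def mat_1_affmat algebra_simps)

lemma Zhat_mult: "u \<in> Zhat \<Longrightarrow> v \<in> Zhat \<Longrightarrow> u * v \<in> Zhat"
  by (simp add: Zhat_def fa_component_times Zp_mult)

lemma Zhat_one: "1 \<in> Zhat"
  by (simp add: Zhat_def fa_component_one Qp_one Zp_of_rat)

lemma Zhat_units_comm_group: "comm_group Zhat_units_group"
proof (rule comm_groupI)
  fix u v assume "u \<in> carrier Zhat_units_group" "v \<in> carrier Zhat_units_group"
  then obtain u' v' where *: "u \<in> Zhat" "v \<in> Zhat" "u' \<in> Zhat" "v' \<in> Zhat" "u * u' = 1" "v * v' = 1"
    by (auto simp: Zhat_units_group_def Zhat_units_def)
  have "u * v * (u' * v') = (u * u') * (v * v')" by (simp add: algebra_simps)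
  hence "u * v * (u' * v') = 1" using * by simp
  thus "u \<otimes>\<^bsub>Zhat_units_group\<^esub> v \<in> carrier Zhat_units_group"
    using * Zhat_mult unfolding Zhat_units_group_def Zhat_units_def by auto
next
  fix u assume "u \<in> carrier Zhat_units_group"
  then obtain u' where "u \<in> Zhat" "u' \<in> Zhat" "u * u' = 1"
    by (auto simp: Zhat_units_group_def Zhat_units_def)
  hence "u' \<in> Zhat_units" "u' * u = 1" by (auto simp: Zhat_units_def mult.commute)
  thus "\<exists>v\<in>carrier Zhat_units_group. v \<otimes>\<^bsub>Zhat_units_group\<^esub> u = \<one>\<^bsub>Zhat_units_group\<^esub>"
    by (auto simp: Zhat_units_group_def)
qed (use Zhat_one in \<open>auto simp: Zhat_units_group_def Zhat_units_def algebra_simps\<close>)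

lemma adele_of_Zhat_mult: "adele_of_Zhat (u * v) = adele_of_Zhat u * adele_of_Zhat v"
  and adele_of_Zhat_one: "adele_of_Zhat 1 = 1"
  by (simp_all add: adele_of_Zhat_def times_prod_def one_prod_def)

lemma Zhat_act_C_group_action: "group_action Zhat_units_group C_Q Zhat_act_C"
  unfolding C_Q_def Zhat_act_C_def
proof (rule quotient_group_action[OF PQ_act_A2_group_action])
  show "group Zhat_units_group" using Zhat_units_comm_group by (rule comm_group.axioms(2))
qed (auto simp: Zhat_units_group_def Zhat_act_A2_def PQ_act_A2_def adele_of_Zhat_mult
    adele_of_Zhat_one algebra_simps)

lemma GL1_group_group: "group (GL1_group :: ('a::comm_ring_1^2^2) monoid)"
proof (rule groupI)
  fix x :: "'a^2^2" assume "x \<in> carrier GL1_group"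
  then obtain a where x: "x = affmat a 0" "a dvd 1" by (auto simp: GL1_group_def)
  then obtain c where c: "a * c = 1" by (metis dvdE)
  have "affmat c 0 \<otimes>\<^bsub>GL1_group\<^esub> x = \<one>\<^bsub>GL1_group\<^esub>"
    using c by (simp add: x GL1_group_def mat_1_affmat mult.commute)
  moreover have "affmat c 0 \<in> carrier GL1_group"
    using c by (auto simp: GL1_group_def intro!: dvdI[of 1 c a] simp: mult.commute)
  ultimately show "\<exists>y\<in>carrier GL1_group. y \<otimes>\<^bsub>GL1_group\<^esub> x = \<one>\<^bsub>GL1_group\<^esub>" by blast
next
  fix x y :: "'a^2^2" assume "x \<in> carrier GL1_group" "y \<in> carrier GL1_group"
  thus "x \<otimes>\<^bsub>GL1_group\<^esub> y \<in> carrier GL1_group"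
    by (auto simp: GL1_group_def) (metis mult_dvd_mono mult_1)
qed (auto simp: GL1_group_def mat_1_affmat algebra_simps)

lemma K_subgroup: "subgroup K_Zhat GL1_group"
proof -
  interpret GL1: group "GL1_group :: (adele^2^2) monoid" by (rule GL1_group_group)
  interpret Z: comm_group Zhat_units_group by (rule Zhat_units_comm_group)
  have inv: "\<exists>v\<in>Zhat_units. u * v = 1" if "u \<in> Zhat_units" for u
    using Z.r_inv_ex[of u] that by (simp add: Zhat_units_group_def)
  have mult: "u * v \<in> Zhat_units" if "u \<in> Zhat_units" "v \<in> Zhat_units" for u v
    using Z.m_closed[of u v] that by (simp add: Zhat_units_group_def)
  have one: "1 \<in> Zhat_units" using Z.one_closed by (simp add: Zhat_units_group_def)
  have sub: "K_Zhat \<subseteq> carrier GL1_group"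
  proof
    fix k assume "k \<in> K_Zhat"
    then obtain u where u: "u \<in> Zhat_units" "k = affmat (adele_of_Zhat u) 0" by (auto simp: K_Zhat_def)
    then obtain v where "u * v = 1" using inv by blast
    hence "1 = adele_of_Zhat u * adele_of_Zhat v"
      by (simp add: adele_of_Zhat_mult[symmetric] adele_of_Zhat_one)
    hence "adele_of_Zhat u dvd 1" by (rule dvdI)
    thus "k \<in> carrier GL1_group" unfolding u GL1_group_def partial_object.simps by blast
  qed
  show ?thesis
  proof (rule GL1.subgroupI[OF sub])
    show "K_Zhat \<noteq> {}" using one by (auto simp: K_Zhat_def)
    fix k assume k: "k \<in> K_Zhat"
    then obtain u where u: "u \<in> Zhat_units" "k = affmat (adele_of_Zhat u) 0" by (auto simp: K_Zhat_def)
    then obtain v where v: "v \<in> Zhat_units" "u * v = 1" using inv by blast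
    have kv: "affmat (adele_of_Zhat v) 0 \<in> K_Zhat" using v by (auto simp: K_Zhat_def)
    have "affmat (adele_of_Zhat v) 0 \<otimes>\<^bsub>GL1_group\<^esub> k = \<one>\<^bsub>GL1_group\<^esub>"
      using u v by (simp add: GL1_group_def mat_1_affmat adele_of_Zhat_mult[symmetric]
          adele_of_Zhat_one mult.commute)
    hence "inv\<^bsub>GL1_group\<^esub> k = affmat (adele_of_Zhat v) 0"
      using k kv sub by (intro GL1.inv_equality) auto
    thus "inv\<^bsub>GL1_group\<^esub> k \<in> K_Zhat" using kv by simp
  next
    fix k l assume "k \<in> K_Zhat" "l \<in> K_Zhat"
    thus "k \<otimes>\<^bsub>GL1_group\<^esub> l \<in> K_Zhat"
      using mult by (force simp: K_Zhat_def GL1_group_def adele_of_Zhat_mult[symmetric])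
  qed
qed

lemma K_act_group_action: "group_action K_group PQ_Pbar K_act"
  unfolding PQ_Pbar_def K_act_def
proof (rule quotient_group_action[OF PQ_act_Pbar_group_action])
  show "group K_group"
    unfolding K_group_def by (rule subgroup.subgroup_is_group[OF K_subgroup GL1_group_group])
qed (auto simp: K_group_def GL1_group_def K_Zhat_def Pbar_def P_group_def mat_1_affmat algebra_simps)

lemma PR_act_orbit:
  assumes "g \<in> carrier P_group" "m \<in> Pbar"
  shows "PR_act (orbit P_group PQ_act_Pbar m) g = orbit P_group PQ_act_Pbar (m ** PR_emb g)"
  unfolding PR_act_def
  by (rule image_orbit) (use assms in \<open>auto simp: P_group_def Pbar_def algebra_simps\<close>)

lemma PR_act_closed: "D \<in> PQ_Pbar \<Longrightarrow> g \<in> carrier P_group \<Longrightarrow> PR_act D g \<in> PQ_Pbar"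
proof -
  assume "D \<in> PQ_Pbar" and g: "g \<in> carrier P_group"
  then obtain m where m: "m \<in> Pbar" "D = orbit P_group PQ_act_Pbar m"
    by (auto simp: PQ_Pbar_def orbits_def)
  have "m ** PR_emb g \<in> Pbar" using m g by (auto simp: P_group_def Pbar_def)
  thus ?thesis using m g by (auto simp: PR_act_orbit PQ_Pbar_def orbits_def)
qed

lemma PR_act_one: "PR_act D (mat 1) = D"
proof -
  have "PR_emb (mat 1) = mat 1" by (simp add: mat_1_affmat) (simp add: zero_prod_def one_prod_def)
  thus ?thesis by (simp add: PR_act_def)
qed

lemma PR_act_mult:
  assumes "g \<in> carrier P_group" "h \<in> carrier P_group"
  shows "PR_act D (g ** h) = PR_act (PR_act D g) h"
proof -
  have "PR_emb (g ** h) = PR_emb g ** PR_emb h"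
    using assms by (auto simp: P_group_def times_prod_def)
  thus ?thesis by (simp add: PR_act_def image_image matrix_mul_assoc)
qed

end

theory Submission
  imports Defs
begin

text \<open>
  Parts (i) and (ii) are formal. The map \<^const>\<open>iota\<close> is a bijection which carries the action of
  \<open>P(\<rat>)\<close> on pairs to left multiplication of matrices, because the product of the matrices
  \<open>(a, b; 0, 1)\<close> and \<open>(y, x; 0, 1)\<close> is \<open>(a y, a x + b; 0, 1)\<close>; and it carries multiplication of
  \<open>y\<close> by a unit \<open>u\<close> of \<^const>\<open>Zhat\<close> to right multiplication by \<open>(u, 0; 0, 1)\<close>. An equivariant
  bijection induces a bijection of the orbit sets (\<open>bij_betw_orbits\<close>), where equivariance may be
  taken along a map \<open>\<theta>\<close> of the acting groups. This is used once for \<open>P(\<rat>)\<close>, with \<open>\<theta>\<close> the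
  identity, and once more on the resulting quotients, with \<open>\<theta>\<close> the identification of the units of
  \<^const>\<open>Zhat\<close> with \<open>K\<close>.

  For part (iii), the conditions \<open>y\<^sub>f \<noteq> 0\<close> and \<open>y\<^sub>\<infinity> \<noteq> 0\<close> are invariant under \<open>P(\<rat>)\<close> and \<open>P(\<real>)\<close>,
  since both groups multiply each of the components \<open>y\<^sub>f\<close> and \<open>y\<^sub>\<infinity>\<close> by a unit. So \<open>V\<close> is open as
  soon as the nonzero finite adeles form an open set; this holds because points of \<open>\<rat>\<^sub>p\<close> are
  closed and \<open>\<int>\<^sub>p\<close> is open in \<open>\<rat>\<^sub>p\<close> by the ultrametric inequality. If \<open>(\<alpha>, \<beta>; 0, 1)\<close> in
  \<open>P(\<real>)\<close> fixes the class of \<open>(y, x; 0, 1)\<close>, then some \<open>(a, b; 0, 1)\<close> in \<open>P(\<rat>)\<close> has the same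
  effect on this matrix. But \<open>P(\<real>)\<close> does not touch the finite components, so \<open>a y\<^sub>f = y\<^sub>f\<close> and
  \<open>a x\<^sub>f + b = x\<^sub>f\<close>. Since nonzero rationals are units in the finite adeles, \<open>y\<^sub>f \<noteq> 0\<close> gives
  \<open>a = 1\<close>, and then \<open>b = 0\<close>. At the archimedean place what remains is \<open>\<alpha> y\<^sub>\<infinity> = y\<^sub>\<infinity>\<close> and
  \<open>\<beta> y\<^sub>\<infinity> = 0\<close>, whence \<open>\<alpha> = 1\<close> and \<open>\<beta> = 0\<close> because \<open>y\<^sub>\<infinity> \<noteq> 0\<close>.
\<close>


section \<open>Orbits under equivariant bijections\<close>

text \<open>
  Surjectivity of \<open>\<theta>\<close> is what makes the image of an orbit a whole orbit rather than a part of one.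
\<close>

lemma image_orbit_equivariant:
  assumes "\<theta> ` carrier G = carrier H"
    and "\<And>g. g \<in> carrier G \<Longrightarrow> f (\<phi> g x) = \<psi> (\<theta> g) (f x)"
  shows "f ` orbit G \<phi> x = orbit H \<psi> (f x)"
  unfolding orbit_def assms(1)[symmetric] using assms(2) by force

lemma bij_betw_orbits:
  assumes act: "group_action G E \<phi>" and f: "bij_betw f E F"
    and \<theta>: "\<theta> ` carrier G = carrier H"
    and equiv: "\<And>g x. g \<in> carrier G \<Longrightarrow> x \<in> E \<Longrightarrow> f (\<phi> g x) = \<psi> (\<theta> g) (f x)"
  shows "bij_betw (\<lambda>C. f ` C) (orbits G E \<phi>) (orbits H F \<psi>)"
proof -
  have img: "f ` orbit G \<phi> x = orbit H \<psi> (f x)" if "x \<in> E" for x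
    by (rule image_orbit_equivariant[OF \<theta>]) (use equiv that in auto)
  have sub: "C \<subseteq> E" if "C \<in> orbits G E \<phi>" for C
    using that group_action.element_image[OF act] by (auto simp: orbits_def orbit_def)
  show ?thesis
  proof (rule bij_betw_imageI)
    show "inj_on (\<lambda>C. f ` C) (orbits G E \<phi>)"
      using f sub by (auto intro!: inj_onI simp: bij_betw_def inj_on_image_eq_iff)
    have "orbits G E \<phi> = orbit G \<phi> ` E" "orbits H F \<psi> = orbit H \<psi> ` f ` E"
      using bij_betw_imp_surj_on[OF f] by (auto simp: orbits_def)
    thus "(\<lambda>C. f ` C) ` orbits G E \<phi> = orbits H F \<psi>"
      by (simp add: image_image img cong: image_cong_simp)
  qed
qed


section \<open>Identification of the adelic quotients\<close>

lemma bij_iota: "bij_betw iota UNIV Pbar"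
  by (rule bij_betw_byWitness[where f' = "\<lambda>m. (m $ 1 $ 2, m $ 1 $ 1)"])
    (auto simp: iota_def Pbar_def)

lemma iota_equivariant:
  assumes "g \<in> carrier P_group"
  shows "iota (PQ_act_A2 g z) = PQ_act_Pbar g (iota z)"
  using assms by (cases z) (auto simp: P_group_def PQ_act_A2_def iota_def)

lemma j_map_orbit: "j_map (orbit P_group PQ_act_A2 z) = orbit P_group PQ_act_Pbar (iota z)"
  unfolding j_map_def by (rule image_orbit) (rule iota_equivariant)

lemma bij_j_map: "bij_betw j_map C_Q PQ_Pbar"
  using bij_betw_orbits[OF PQ_act_A2_group_action bij_iota, of id P_group PQ_act_Pbar]
    iota_equivariant
  by (simp add: C_Q_def PQ_Pbar_def j_map_def[abs_def])

lemma K_Zhat_eq_image: "(\<lambda>u. affmat (adele_of_Zhat u) 0) ` carrier Zhat_units_group = carrier K_group"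
  by (auto simp: Zhat_units_group_def K_group_def K_Zhat_def)

lemma iota_Zhat_act: "iota (Zhat_act_A2 u z) = iota z ** affmat (adele_of_Zhat u) 0"
  by (cases z) (simp add: iota_def Zhat_act_A2_def mult.commute)

lemma j_map_Zhat_act:
  assumes "C \<in> C_Q"
  shows "j_map (Zhat_act_C u C) = K_act (affmat (adele_of_Zhat u) 0) (j_map C)"
proof -
  have "j_map C \<in> PQ_Pbar" using bij_j_map assms by (auto simp: bij_betw_def)
  thus ?thesis
    using assms by (simp add: Zhat_act_C_def K_act_def j_map_def image_image iota_Zhat_act)
qed

lemma j_map_Zhat_orbit:
  assumes "C \<in> C_Q"
  shows "j_map ` orbit Zhat_units_group Zhat_act_C C = orbit K_group K_act (j_map C)"
  using K_Zhat_eq_image j_map_Zhat_act[OF assms] by (rule image_orbit_equivariant)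

lemma bij_Gamma_Q: "bij_betw (\<lambda>B. j_map ` B) Gamma_Q PQ_Pbar_K"
  unfolding Gamma_Q_def PQ_Pbar_K_def
  using Zhat_act_C_group_action bij_j_map K_Zhat_eq_image j_map_Zhat_act by (rule bij_betw_orbits)


section \<open>The nonzero finite adeles are open\<close>

lemma openin_Qp_Zp:
  assumes p: "prime p"
  shows "openin (Qp_topology p) (Zp p)"
proof -
  interpret M: Metric_space "carrier (Qp p)" "Qp_dist p" by (rule Qp_Metric_space[OF p])
  interpret Q: cring "Qp p" by (rule Qp_cring[OF p])
  have "M.mball a 1 \<subseteq> Zp p" if a: "a \<in> Zp p" for a
  proof
    fix b assume "b \<in> M.mball a 1"
    hence ac: "a \<in> carrier (Qp p)" and b: "b \<in> carrier (Qp p)"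
      and d: "Qp_abs p (a \<ominus>\<^bsub>Qp p\<^esub> b) < 1"
      by (auto simp: M.mball_def Qp_dist_def)
    \<comment> \<open>by the ultrametric inequality \<open>\<int>\<^sub>p\<close> is an additive group, so it contains \<open>b = a - (a - b)\<close>\<close>
    have "a \<ominus>\<^bsub>Qp p\<^esub> b \<in> Zp p" using d ac b by (simp add: Zp_def)
    hence "a \<oplus>\<^bsub>Qp p\<^esub> (\<ominus>\<^bsub>Qp p\<^esub> (a \<ominus>\<^bsub>Qp p\<^esub> b)) \<in> Zp p"
      using a by (intro Zp_add Zp_uminus p)
    moreover have "a \<oplus>\<^bsub>Qp p\<^esub> (\<ominus>\<^bsub>Qp p\<^esub> (a \<ominus>\<^bsub>Qp p\<^esub> b)) = b"
      using ac b by (simp add: a_minus_def Q.minus_add Q.r_neg2)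
    ultimately show "b \<in> Zp p" by simp
  qed
  moreover have "Zp p \<subseteq> carrier (Qp p)" by (auto simp: Zp_def)
  ultimately show ?thesis
    unfolding Qp_topology_def M.openin_mtopology using zero_less_one by blast
qed

lemma openin_Qp_carrier: "prime p \<Longrightarrow> openin (Qp_topology p) (carrier (Qp p))"
  using Metric_space.topspace_mtopology[OF Qp_Metric_space] openin_topspace
  unfolding Qp_topology_def by metis

lemma openin_Qp_nonzero:
  assumes p: "prime p"
  shows "openin (Qp_topology p) (carrier (Qp p) - {\<zero>\<^bsub>Qp p\<^esub>})"
proof -
  interpret M: Metric_space "carrier (Qp p)" "Qp_dist p" by (rule Qp_Metric_space[OF p])
  interpret Q: cring "Qp p" by (rule Qp_cring[OF p])
  have "closedin M.mtopology {\<zero>\<^bsub>Qp p\<^esub>}"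
    using M.t1_space_mtopology by (simp add: t1_space_closedin_singleton)
  thus ?thesis
    unfolding Qp_topology_def using openin_diff[OF openin_topspace] by fastforce
qed

text \<open>
  A nonzero adele \<open>y\<close> has a nonzero component at some prime \<open>q\<close>. The basic open set that requires a
  nonzero component at \<open>q\<close>, and integrality at all other primes where \<open>y\<close> itself is integral, is a
  neighbourhood of \<open>y\<close> without \<open>0\<close>.
\<close>

lemma open_nonzero_finite_adele: "open {y :: finite_adele. y \<noteq> 0}"
proof (subst open_subopen, intro ballI)
  fix y :: finite_adele assume "y \<in> {y. y \<noteq> 0}"
  then obtain q where q: "prime q" and yq: "fa_component y q \<noteq> \<zero>\<^bsub>Qp q\<^esub>"
    using fa_eqI[of y 0] fa_component_zero by auto
  define U where "U p = (if p = q then carrier (Qp q) - {\<zero>\<^bsub>Qp q\<^esub>}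
    else if fa_component y p \<in> Zp p then Zp p else carrier (Qp p))" for p
  let ?N = "{x. \<forall>p. prime p \<longrightarrow> fa_component x p \<in> U p}"
  have "openin (Qp_topology p) (U p)" if "prime p" for p
    using that by (auto simp: U_def intro: openin_Qp_Zp openin_Qp_carrier openin_Qp_nonzero)
  moreover have "finite {p. prime p \<and> U p \<noteq> Zp p}"
  proof (rule finite_subset)
    show "{p. prime p \<and> U p \<noteq> Zp p} \<subseteq> insert q {p. prime p \<and> fa_component y p \<notin> Zp p}"
      by (auto simp: U_def)
    show "finite (insert q {p. prime p \<and> fa_component y p \<notin> Zp p})"
      using restricted_product_finite[OF fa_component] by simp
  qed
  ultimately have "open ?N"
    unfolding open_finite_adele_def by (intro generate_topology.Basis) blast
  moreover have "y \<in> ?N"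
    using yq q fa_component_carrier by (auto simp: U_def)
  moreover have "?N \<subseteq> {y. y \<noteq> 0}"
    using q by (auto simp: U_def fa_component_zero)
  ultimately show "\<exists>T. open T \<and> y \<in> T \<and> T \<subseteq> {y. y \<noteq> 0}" by blast
qed


section \<open>The open set \<open>V\<close> and the action of \<open>P(\<real>)\<close>\<close>

text \<open>
  The finite adeles have zero divisors, but a nonzero rational is a unit there. Hence a rational that
  annihilates one nonzero finite adele, such as \<open>a - 1\<close> when \<open>a y\<^sub>f = y\<^sub>f\<close>, must vanish.
\<close>

lemma fa_of_rat_mult_eq_0_iff: "fa_of_rat q * y = 0 \<longleftrightarrow> q = 0 \<or> y = 0"
proof (cases "q = 0")
  case False
  have "fa_of_rat (inverse q) * (fa_of_rat q * y) = fa_of_rat (inverse q * q) * y"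
    by (simp add: fa_of_rat_mult mult.assoc)
  also have "\<dots> = y" using False by (simp add: one_finite_adele_def[symmetric])
  finally show ?thesis using False by auto
qed (simp add: zero_finite_adele_def[symmetric])

lemma fa_of_rat_eq_iff: "fa_of_rat q = fa_of_rat r \<longleftrightarrow> q = r"
proof -
  have "fa_of_rat q = fa_of_rat r \<longleftrightarrow> fa_of_rat (q - r) * 1 = 0"
    using fa_of_rat_add[of "q - r" r] by simp
  thus ?thesis unfolding fa_of_rat_mult_eq_0_iff by simp
qed

lemma affmat_in_orbit_iff:
  "affmat y' x' \<in> orbit P_group PQ_act_Pbar (affmat y x) \<longleftrightarrow>
    (\<exists>a b. a \<noteq> 0 \<and> y' = adele_of_rat a * y \<and> x' = adele_of_rat a * x + adele_of_rat b)"
  by (force simp: orbit_def P_group_def dvd_field_iff)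

lemma affmat_in_own_orbit: "affmat y x \<in> orbit P_group PQ_act_Pbar (affmat y x)"
  using affmat_in_orbit_iff[of y x y x] adele_of_rat_simps(1,2)
  by (metis add_0_right mult_1 zero_neq_one)

lemma V_quot_iff:
  "orbit P_group PQ_act_Pbar (affmat y x) \<in> V_quot \<longleftrightarrow> fst y \<noteq> 0 \<and> snd y \<noteq> 0"
proof
  assume "orbit P_group PQ_act_Pbar (affmat y x) \<in> V_quot"
  then obtain y' x' where eq: "orbit P_group PQ_act_Pbar (affmat y x)
      = orbit P_group PQ_act_Pbar (affmat y' x')" and nz: "fst y' \<noteq> 0" "snd y' \<noteq> 0"
    by (auto simp: V_quot_def)
  obtain a where "a \<noteq> 0" "y = adele_of_rat a * y'"
    using affmat_in_own_orbit[of y x] unfolding eq affmat_in_orbit_iff by blast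
  thus "fst y \<noteq> 0 \<and> snd y \<noteq> 0"
    using nz by (simp add: adele_of_rat_def times_prod_def fa_of_rat_mult_eq_0_iff)
qed (unfold V_quot_def, blast)

lemma openin_V_quot: "openin PQ_Pbar_topology V_quot"
proof -
  let ?\<pi> = "orbit P_group PQ_act_Pbar"
  have qm: "quotient_map (top_of_set Pbar) PQ_Pbar_topology ?\<pi>"
    unfolding PQ_Pbar_topology_def by (rule quotient_map_quotient_topology)
  let ?W = "{m :: adele^2^2. fst (m $ 1 $ 1) \<noteq> 0 \<and> snd (m $ 1 $ 1) \<noteq> 0}"
  have "open ((\<lambda>m :: adele^2^2. fst (m $ 1 $ 1)) -` {y. y \<noteq> 0})"
    by (intro open_vimage open_nonzero_finite_adele continuous_intros)
  moreover have "open ((\<lambda>m :: adele^2^2. snd (m $ 1 $ 1)) -` {r. r \<noteq> 0})"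
    by (intro open_vimage open_Collect_neq continuous_intros)
  ultimately have "open ?W"
    by (auto dest: open_Int simp: vimage_def Collect_conj_eq)
  moreover have "{m \<in> topspace (top_of_set Pbar). ?\<pi> m \<in> V_quot} = Pbar \<inter> ?W"
    by (auto simp: Pbar_def V_quot_iff)
  ultimately have "openin (top_of_set Pbar) {m \<in> topspace (top_of_set Pbar). ?\<pi> m \<in> V_quot}"
    by (auto simp: openin_open_Int)
  moreover have "V_quot \<subseteq> topspace PQ_Pbar_topology"
    using quotient_imp_surjective_map[OF qm] by (auto simp: V_quot_def)
  ultimately show ?thesis using qm unfolding quotient_map_def by blast
qed

lemma PR_act_affmat_orbit:
  assumes "\<alpha> \<noteq> 0"
  shows "PR_act (orbit P_group PQ_act_Pbar (affmat y x)) (affmat \<alpha> \<beta>)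
    = orbit P_group PQ_act_Pbar (affmat (y * (1, \<alpha>)) (y * (0, \<beta>) + x))"
  using assms by (subst PR_act_orbit) (auto simp: P_group_def dvd_field_iff)

lemma P_group_real_cases:
  assumes "g \<in> carrier (P_group :: (real^2^2) monoid)"
  obtains \<alpha> \<beta> where "\<alpha> \<noteq> 0" "g = affmat \<alpha> \<beta>"
  using assms unfolding P_group_def by fastforce

lemma PR_act_V_quot:
  assumes "D \<in> V_quot" and "g \<in> carrier P_group"
  shows "PR_act D g \<in> V_quot"
proof -
  obtain y x where D: "D = orbit P_group PQ_act_Pbar (affmat y x)"
    and nz: "fst y \<noteq> 0" "snd y \<noteq> 0"
    using assms(1) by (auto simp: V_quot_def)
  obtain \<alpha> \<beta> where "\<alpha> \<noteq> 0" "g = affmat \<alpha> \<beta>" using assms(2) by (rule P_group_real_cases)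
  thus ?thesis using nz unfolding D by (simp add: PR_act_affmat_orbit V_quot_iff times_prod_def)
qed

lemma PR_act_free_on_V_quot:
  assumes "D \<in> V_quot" and g: "g \<in> carrier P_group" and fixed: "PR_act D g = D"
  shows "g = mat 1"
proof -
  obtain y x where D: "D = orbit P_group PQ_act_Pbar (affmat y x)"
    and yf: "fst y \<noteq> 0" and yinf: "snd y \<noteq> 0"
    using assms(1) by (auto simp: V_quot_def)
  obtain \<alpha> \<beta> where \<alpha>: "\<alpha> \<noteq> 0" and g_eq: "g = affmat \<alpha> \<beta>" using g by (rule P_group_real_cases)
  \<comment> \<open>fixing the orbit means moving its representative by a rational matrix\<close>
  have "affmat (y * (1, \<alpha>)) (y * (0, \<beta>) + x) \<in> orbit P_group PQ_act_Pbar (affmat y x)"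
    using affmat_in_own_orbit fixed unfolding D g_eq PR_act_affmat_orbit[OF \<alpha>] by metis
  then obtain a b where y: "y * (1, \<alpha>) = adele_of_rat a * y"
    and x: "y * (0, \<beta>) + x = adele_of_rat a * x + adele_of_rat b"
    unfolding affmat_in_orbit_iff by blast
  have "fst y = fa_of_rat a * fst y"
    using arg_cong[OF y, of fst] by (simp add: times_prod_def adele_of_rat_def)
  moreover have "fa_of_rat a * fst y = fa_of_rat (a - 1) * fst y + fst y"
    using fa_of_rat_add[of "a - 1" 1] by (simp add: one_finite_adele_def[symmetric] distrib_right)
  ultimately have "fa_of_rat (a - 1) * fst y = 0" by simp
  hence a: "a = 1" using yf by (simp add: fa_of_rat_mult_eq_0_iff)
  have "fa_of_rat b = fa_of_rat 0"
    using arg_cong[OF x, of fst] a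
    by (simp add: times_prod_def adele_of_rat_def one_finite_adele_def[symmetric]
        zero_finite_adele_def[symmetric])
  hence b: "b = 0" by (simp add: fa_of_rat_eq_iff)
  have "\<alpha> = 1"
    using arg_cong[OF y, of snd] a yinf by (simp add: times_prod_def adele_of_rat_def)
  moreover have "\<beta> = 0"
    using arg_cong[OF x, of snd] a b yinf by (simp add: times_prod_def adele_of_rat_def)
  ultimately show ?thesis by (simp add: g_eq mat_1_affmat)
qed

theorem lemma5p4:
  shows
    "(bij_betw iota UNIV (Pbar :: (adele^2^2) set) \<and>
      (\<forall>g \<in> carrier P_group. \<forall>z. iota (PQ_act_A2 g z) = PQ_act_Pbar g (iota z)) \<and>
      (\<forall>z. j_map (orbit P_group PQ_act_A2 z) = orbit P_group PQ_act_Pbar (iota z)) \<and>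
      bij_betw j_map C_Q PQ_Pbar)
   \<and> ((\<forall>C \<in> C_Q. j_map ` orbit Zhat_units_group Zhat_act_C C = orbit K_group K_act (j_map C)) \<and>
      bij_betw (\<lambda>B. j_map ` B) Gamma_Q PQ_Pbar_K)
   \<and> ((\<forall>x y. orbit P_group PQ_act_Pbar (affmat y x) \<in> V_quot \<longleftrightarrow> fst y \<noteq> 0 \<and> snd y \<noteq> 0) \<and>
      openin PQ_Pbar_topology V_quot \<and>
      (\<forall>D \<in> V_quot. \<forall>g \<in> carrier P_group. PR_act D g \<in> V_quot) \<and>
      (\<forall>D \<in> V_quot. \<forall>g \<in> carrier P_group. PR_act D g = D \<longrightarrow> g = mat 1))"
  by (intro conjI ballI allI impI;
      rule bij_iota iota_equivariant j_map_orbit bij_j_map j_map_Zhat_orbit bij_Gamma_Q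
        V_quot_iff openin_V_quot PR_act_V_quot PR_act_free_on_V_quot; assumption)

end
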